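(* Let $\mathbf X=(X,\mathcal E)$ and $\mathbf Y=(Y,\mathcal F)$ be coarse spaces. Fix locally admissible modules $\mathcal H_{\mathbf X}$ and $\mathcal H_{\mathbf Y}$, a bounded operator $T\colon\mathcal H_{\mathbf X}\to\mathcal H_{\mathbf Y}$ and constants $\mu,\eta$ with $0\le\mu<\eta/2$. Suppose there are chains of submodules $p_X^0\le p_X'\le p_X''$ of $\mathcal H_{\mathbf X}$ and $p_Y^0\le p_Y'\le p_Y''$ of $\mathcal H_{\mathbf Y}$ with \[ \|p_Y'Tp_X^0-Tp_X^0\|\le\mu,\quad \|p_Y''Tp_X'-Tp_X'\|\le\mu,\quad \|p_X'T^*p_Y^0-T^*p_Y^0\|\le\mu,\quad \|p_X''T^*p_Y'-T^*p_Y'\|\le\mu . \] Further suppose that: (i) $p_X^0$ and $p_Y^0$ are faithful; (ii) $p_X'$ and $p_Y'$ are discrete; (iii) the restrictions of $T$ and $T^*$ to $p_X'(\mathcal H_{\mathbf X})$ and $p_Y'(\mathcal H_{\mathbf Y})$ respectively are $\eta$-bounded from below; (iv) $Tp_X''\colon p_X''(\mathcal H_{\mathbf X})\to\mathcal H_{\mathbf Y}$ and $T^*p_Y''\colon p_Y''(\mathcal H_{\mathbf Y})\to\mathcal H_{\mathbf X}$ are weakly quasi-controlled. Then for every $\mu<\delta<\eta$ there are $E\in\mathcal E$ and $F\in\mathcal F$ large enough such that $f^{p_Y''Tp_X''}_{\delta-\mu,F,E}$ defines a coarse equivalence $\mathbf X\to\mathbf Y$ whose coarse inverse is defined by $f^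{p_X''T^*p_Y''}_{\delta-\mu,E,F}$.
   Context: A relation from $X$ to $Y$ is a subset $R\subseteq Y\times X$; $R(A)=\{y\mid\exists x\in A,(y,x)\in R\}$, $R^{\rm T}$ is its transpose, $\circ$ denotes composition of relations. A coarse structure on $X$ is a family $\mathcal E$ of subsets of $X\times X$ (entourages) closed under subsets, finite unions, transposition and composition, and containing the diagonal; $(X,\mathcal E)$ is a coarse space. $A\subseteq X$ is $E$-bounded if $A\times A\subseteq E$, bounded if $E$-bounded for some $E\in\mathcal E$. A gauge is a symmetric entourage containing the diagonal. $D\subseteq X$ is coarsely dense if $X=E(D)$ for some $E\in\mathcal E$. A module $\mathcal H_{\mathbf X}$ over $\mathbf X$ is a Hilbert space with a unital Boolean algebra $\mathfrak A$ of subsets of $X$ (measurable sets) and a map $A\mapsto1_A$ from $\mathfrak A$ to projections with $1_{A\cap A'}=1_A1_{A'}$, $1_{A\sqcup A'}=1_A+1_{A'}$ for disjoint sets, $1_X=\mathrm{id}$, and such that for some gauge $\widetilde E$ the subspaces $1_A(\mathcal H_{\mathbf X})$, $A$ measurable $\widetilde E$-bounded, span a dense subspace. It is locally admissible if for some gauge $\widetilde E$ every bounded $A\subseteq X$ is contained in a measurable set $A'\subseteq\widetilde E(A)$. It is discrete if there are a gauge $\widetilde E$ and a partition $X=\bigsqcup_iA_i$ into $\widetilde E$-bounded measurable sets with $\sum_i1_{A_i}=1$ strongly and such that $C\subseteq X$ is measurable whenever all $C\cap A_i$ are. It is faithful if for some gauge $\widetilde E$ the union of the measurable $\widetilde E$-bounded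 $A$ with $1_A\ne0$ is coarsely dense. A submodule of $(\mathfrak A,\mathcal H_{\mathbf X},1_\bullet)$ is a module $(\mathfrak A',\mathcal H',1'_\bullet)$ over the same coarse space with $\mathfrak A'\subseteq\mathfrak A$, $\mathcal H'\subseteq\mathcal H_{\mathbf X}$ a closed subspace, and $1'_A(v)=1_A(v)$ for $v\in\mathcal H'$, $A\in\mathfrak A'$. A submodule is denoted by the orthogonal projection $p$ onto $\mathcal H'$; $p\le q$ means that $p$ is a submodule of $q$. $t\in\mathcal B(\mathcal H_{\mathbf X})$ has $E$-controlled propagation if $1_{A'}t1_A=0$ for all measurable $A,A'$ with $A'\cap E(A)=\emptyset$; $s\in\mathcal B(\mathcal H_{\mathbf Y})$ is $\varepsilon$-$F$-quasi-local if $\|1_{B'}s1_B\|\le\varepsilon$ for all measurable $B,B'$ with $B'\cap F(B)=\emptyset$. An operator $S\colon\mathcal H_{\mathbf X}\to\mathcal H_{\mathbf Y}$ between modules is weakly quasi-controlled if for every $E\in\mathcal E$, $\varepsilon>0$ there is $F\in\mathcal F$ such that $StS^*$ is $(\varepsilon\|t\|)$-$F$-quasi-local for every $t$ of $E$-controlled propagation. It is $\eta$-bounded from below if $\|Sv\|\ge\eta\|v\|$ for all $v$. For $S\colon\mathcal H_{\mathbf X}\to\mathcal H_{\mathbf Y}$, $\delta>0$, $E\in\mathcal E$, $F\in\mathcal F$, \[ f^S_{\delta,F,E}=\bigcup\{B\times A\mid B\subseteq Y\ F\text{-bounded},\ A\subseteq X\ E\text{-bounded, both measurable},\ \|1_BS1_A\|>\delta\}\subseteq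 Y\times X; \] here $p_Y''Tp_X''$ is regarded as an operator $\mathcal H_{\mathbf X}\to\mathcal H_{\mathbf Y}$ and $p_X''T^*p_Y''$ as an operator $\mathcal H_{\mathbf Y}\to\mathcal H_{\mathbf X}$. A relation $R\subseteq Y\times X$ is controlled if $R\circ E\circ R^{\rm T}\in\mathcal F$ for every $E\in\mathcal E$. Relations $R,R'\subseteq Y\times X$ are close if for some $E\in\mathcal E,F\in\mathcal F$ one has $R\subseteq F\circ R'\circ E$ and $R'\subseteq F\circ R\circ E$. A coarse map $\mathbf X\to\mathbf Y$ is a closeness class of controlled relations whose projection to $X$ is coarsely dense; each such class contains the graph of a function, and coarse maps are composed by composing representing functions. Two coarse maps $\mathbf X\to\mathbf Y$, $\mathbf Y\to\mathbf X$ are coarse inverses (and coarse equivalences) if both compositions are the classes of the identity maps. *)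

theory Defs
  imports "HOL-Analysis.Analysis"
begin

text \<open>Complex Hilbert spaces. The form is antilinear in its first argument, and its real part is
  the inner product (hence determines the norm) of the underlying real Hilbert space.\<close>

class complex_hilbert = real_inner + complete_space +
  fixes scaleC :: "complex \<Rightarrow> 'a \<Rightarrow> 'a" (infixr "*\<^sub>C" 75)
    and cinner :: "'a \<Rightarrow> 'a \<Rightarrow> complex"
  assumes scaleC_add_right: "c *\<^sub>C (x + y) = c *\<^sub>C x + c *\<^sub>C y"
    and scaleC_add_left: "(c + d) *\<^sub>C x = c *\<^sub>C x + d *\<^sub>C x"
    and scaleC_scaleC: "c *\<^sub>C d *\<^sub>C x = (c * d) *\<^sub>C x"
    and scaleC_one: "1 *\<^sub>C x = x"
    and scaleR_scaleC: "r *\<^sub>R x = complex_of_real r *\<^sub>C x"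
    and cinner_commute: "cinner x y = cnj (cinner y x)"
    and cinner_add_left: "cinner (x + y) z = cinner x z + cinner y z"
    and cinner_scaleC_left: "cinner (c *\<^sub>C x) y = cnj c * cinner x y"
    and inner_eq_Re_cinner: "inner x y = Re (cinner x y)"

global_interpretation cvec: vector_space "scaleC :: complex \<Rightarrow> 'a \<Rightarrow> 'a::complex_hilbert"
  by unfold_locales (simp_all add: scaleC_add_right scaleC_add_left scaleC_scaleC scaleC_one)

text \<open>Hilbert spaces are closed complex subspaces \<open>H\<close> of an ambient type, so that closed subspaces
  of Hilbert spaces are again of this form. Operators defined on \<open>H\<close> are total functions whose
  values outside \<open>H\<close> are irrelevant.\<close>

definition closed_csubspace :: "'h::complex_hilbert set \<Rightarrow> bool" where
  "closed_csubspace H \<longleftrightarrow> cvec.subspace H \<and> closed H"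

definition clinear_on :: "'h::complex_hilbert set \<Rightarrow> ('h \<Rightarrow> 'k::complex_hilbert) \<Rightarrow> bool" where
  "clinear_on H f \<longleftrightarrow>
     (\<forall>x\<in>H. \<forall>y\<in>H. f (x + y) = f x + f y) \<and> (\<forall>c. \<forall>x\<in>H. f (c *\<^sub>C x) = c *\<^sub>C f x)"

definition bounded_op ::
    "'h::complex_hilbert set \<Rightarrow> 'k::complex_hilbert set \<Rightarrow> ('h \<Rightarrow> 'k) \<Rightarrow> bool" where
  "bounded_op H K f \<longleftrightarrow>
     f ` H \<subseteq> K \<and> clinear_on H f \<and> (\<exists>C. \<forall>x\<in>H. norm (f x) \<le> C * norm x)"

text \<open>The operator norm of \<open>f\<close> restricted to \<open>H\<close>; for \<open>H = UNIV\<close> this is \<^const>\<open>onorm\<close>.\<close>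

definition onorm_on :: "'h::complex_hilbert set \<Rightarrow> ('h \<Rightarrow> 'k::complex_hilbert) \<Rightarrow> real" where
  "onorm_on H f = (SUP x\<in>H. norm (f x) / norm x)"

text \<open>The adjoint of a bounded operator with domain \<open>H\<close>.\<close>

definition adj_on :: "'h::complex_hilbert set \<Rightarrow> ('h \<Rightarrow> 'k::complex_hilbert) \<Rightarrow> 'k \<Rightarrow> 'h" where
  "adj_on H f y = (THE z. z \<in> H \<and> (\<forall>x\<in>H. cinner (f x) y = cinner x z))"

definition projection_on :: "'h::complex_hilbert set \<Rightarrow> ('h \<Rightarrow> 'h) \<Rightarrow> bool" where
  "projection_on H p \<longleftrightarrow> bounded_op H H p \<and> (\<forall>x\<in>H. p (p x) = p x) \<and>
     (\<forall>x\<in>H. \<forall>y\<in>H. cinner (p x) y = cinner x (p y))"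

text \<open>The orthogonal projection onto a closed subspace \<open>H\<close>.\<close>

definition oproj :: "'h::complex_hilbert set \<Rightarrow> 'h \<Rightarrow> 'h" where
  "oproj H x = (THE y. y \<in> H \<and> (\<forall>z\<in>H. cinner (x - y) z = 0))"

definition bounded_below_on ::
    "'h::complex_hilbert set \<Rightarrow> real \<Rightarrow> ('h \<Rightarrow> 'k::complex_hilbert) \<Rightarrow> bool" where
  "bounded_below_on H \<eta> f \<longleftrightarrow> (\<forall>x\<in>H. \<eta> * norm x \<le> norm (f x))"


text \<open>A relation from \<open>X\<close> to \<open>Y\<close> is a subset of \<open>Y \<times> X\<close>, with pairs written target first.
  With this convention composition of relations is exactly \<^const>\<open>relcomp\<close>, whereas the image
  \<open>R(A)\<close> is the image under the converse.\<close>

definition rimg :: "('y \<times> 'x) set \<Rightarrow> 'x set \<Rightarrow> 'y set" where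
  "rimg R A = {y. \<exists>x\<in>A. (y, x) \<in> R}"

locale coarse_space =
  fixes X :: "'x set" and \<E> :: "'x rel set"
  assumes entourage_subset: "E \<in> \<E> \<Longrightarrow> E \<subseteq> X \<times> X"
    and diagonal: "Id_on X \<in> \<E>"
    and subset_closed: "E \<in> \<E> \<Longrightarrow> E' \<subseteq> E \<Longrightarrow> E' \<in> \<E>"
    and union_closed: "E \<in> \<E> \<Longrightarrow> E' \<in> \<E> \<Longrightarrow> E \<union> E' \<in> \<E>"
    and transpose_closed: "E \<in> \<E> \<Longrightarrow> E\<inverse> \<in> \<E>"
    and comp_closed: "E \<in> \<E> \<Longrightarrow> E' \<in> \<E> \<Longrightarrow> E O E' \<in> \<E>"

definition ebounded :: "'x rel \<Rightarrow> 'x set \<Rightarrow> bool" where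
  "ebounded E A \<longleftrightarrow> A \<times> A \<subseteq> E"

definition gauge_ent :: "'x set \<Rightarrow> 'x rel set \<Rightarrow> 'x rel \<Rightarrow> bool" where
  "gauge_ent X \<E> E \<longleftrightarrow> E \<in> \<E> \<and> sym E \<and> Id_on X \<subseteq> E"

definition coarsely_dense :: "'x set \<Rightarrow> 'x rel set \<Rightarrow> 'x set \<Rightarrow> bool" where
  "coarsely_dense X \<E> D \<longleftrightarrow> D \<subseteq> X \<and> (\<exists>E\<in>\<E>. X = rimg E D)"

definition controlled_rel ::
    "'x rel set \<Rightarrow> 'y rel set \<Rightarrow> ('y \<times> 'x) set \<Rightarrow> bool" where
  "controlled_rel \<E> \<F> R \<longleftrightarrow> (\<forall>E\<in>\<E>. R O E O R\<inverse> \<in> \<F>)"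

definition close_rel ::
    "'x rel set \<Rightarrow> 'y rel set \<Rightarrow> ('y \<times> 'x) set \<Rightarrow> ('y \<times> 'x) set \<Rightarrow> bool" where
  "close_rel \<E> \<F> R R' \<longleftrightarrow>
     (\<exists>E\<in>\<E>. \<exists>F\<in>\<F>. R \<subseteq> F O R' O E \<and> R' \<subseteq> F O R O E)"

text \<open>The relations whose closeness classes are the coarse maps; \<^term>\<open>Range R\<close> is the projection
  of \<open>R \<subseteq> Y \<times> X\<close> to \<open>X\<close>.\<close>

definition coarse_rel ::
    "'x set \<Rightarrow> 'x rel set \<Rightarrow> 'y set \<Rightarrow> 'y rel set \<Rightarrow> ('y \<times> 'x) set \<Rightarrow> bool" where
  "coarse_rel X \<E> Y \<F> R \<longleftrightarrow>
     R \<subseteq> Y \<times> X \<and> controlled_rel \<E> \<F> R \<and> coarsely_dense X \<E> (Range R)"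

definition coarse_class ::
    "'x set \<Rightarrow> 'x rel set \<Rightarrow> 'y set \<Rightarrow> 'y rel set \<Rightarrow> ('y \<times> 'x) set \<Rightarrow> ('y \<times> 'x) set set" where
  "coarse_class X \<E> Y \<F> R = {R'. coarse_rel X \<E> Y \<F> R' \<and> close_rel \<E> \<F> R R'}"

definition coarse_map ::
    "'x set \<Rightarrow> 'x rel set \<Rightarrow> 'y set \<Rightarrow> 'y rel set \<Rightarrow> ('y \<times> 'x) set set \<Rightarrow> bool" where
  "coarse_map X \<E> Y \<F> \<phi> \<longleftrightarrow> (\<exists>R. coarse_rel X \<E> Y \<F> R \<and> \<phi> = coarse_class X \<E> Y \<F> R)"

definition graph_on :: "'x set \<Rightarrow> ('x \<Rightarrow> 'y) \<Rightarrow> ('y \<times> 'x) set" where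
  "graph_on X f = {(f x, x) | x. x \<in> X}"

text \<open>Composition \<open>\<psi> \<circ> \<phi>\<close> of coarse maps \<open>\<phi>\<close> from \<open>X\<close> to \<open>Y\<close> and \<open>\<psi>\<close> from \<open>Y\<close> to \<open>Z\<close>: the union
  of the closeness classes of \<open>g \<circ> f\<close> over all representing functions. These classes all
  coincide.\<close>

definition coarse_comp ::
    "'x set \<Rightarrow> 'x rel set \<Rightarrow> 'y set \<Rightarrow> 'z set \<Rightarrow> 'z rel set \<Rightarrow>
     ('z \<times> 'y) set set \<Rightarrow> ('y \<times> 'x) set set \<Rightarrow> ('z \<times> 'x) set set" where
  "coarse_comp X \<E> Y Z \<G> \<psi> \<phi> =
     \<Union> {coarse_class X \<E> Z \<G> (graph_on X (g \<circ> f)) | f g.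
           f \<in> X \<rightarrow> Y \<and> g \<in> Y \<rightarrow> Z \<and> graph_on X f \<in> \<phi> \<and> graph_on Y g \<in> \<psi>}"

definition coarse_inverses ::
    "'x set \<Rightarrow> 'x rel set \<Rightarrow> 'y set \<Rightarrow> 'y rel set \<Rightarrow>
     ('y \<times> 'x) set set \<Rightarrow> ('x \<times> 'y) set set \<Rightarrow> bool" where
  "coarse_inverses X \<E> Y \<F> \<phi> \<psi> \<longleftrightarrow>
     coarse_map X \<E> Y \<F> \<phi> \<and> coarse_map Y \<F> X \<E> \<psi> \<and>
     coarse_comp X \<E> Y X \<E> \<psi> \<phi> = coarse_class X \<E> X \<E> (graph_on X id) \<and>
     coarse_comp Y \<F> X Y \<F> \<phi> \<psi> = coarse_class Y \<F> Y \<F> (graph_on Y id)"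

definition coarse_equivalence ::
    "'x set \<Rightarrow> 'x rel set \<Rightarrow> 'y set \<Rightarrow> 'y rel set \<Rightarrow> ('y \<times> 'x) set set \<Rightarrow> bool" where
  "coarse_equivalence X \<E> Y \<F> \<phi> \<longleftrightarrow> (\<exists>\<psi>. coarse_inverses X \<E> Y \<F> \<phi> \<psi>)"


text \<open>The data of a module: measurable sets, underlying Hilbert space, and the operators \<open>1\<^sub>A\<close>.\<close>

record ('x, 'h) cmodule =
  msets :: "'x set set"
  hilb :: "'h set"
  ind :: "'x set \<Rightarrow> 'h \<Rightarrow> 'h"

definition coarse_module ::
    "'x set \<Rightarrow> 'x rel set \<Rightarrow> ('x, 'h::complex_hilbert) cmodule \<Rightarrow> bool" where
  "coarse_module X \<E> M \<longleftrightarrow>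
     closed_csubspace (hilb M) \<and>
     algebra X (msets M) \<and>
     (\<forall>A\<in>msets M. projection_on (hilb M) (ind M A)) \<and>
     (\<forall>A\<in>msets M. \<forall>A'\<in>msets M. \<forall>v\<in>hilb M. ind M (A \<inter> A') v = ind M A (ind M A' v)) \<and>
     (\<forall>A\<in>msets M. \<forall>A'\<in>msets M. A \<inter> A' = {} \<longrightarrow>
        (\<forall>v\<in>hilb M. ind M (A \<union> A') v = ind M A v + ind M A' v)) \<and>
     (\<forall>v\<in>hilb M. ind M X v = v) \<and>
     (\<exists>E. gauge_ent X \<E> E \<and>
        closure (cvec.span (\<Union>A\<in>{A \<in> msets M. ebounded E A}. ind M A ` hilb M)) = hilb M)"

definition locally_admissible ::
    "'x set \<Rightarrow> 'x rel set \<Rightarrow> ('x, 'h::complex_hilbert) cmodule \<Rightarrow> bool" where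
  "locally_admissible X \<E> M \<longleftrightarrow>
     (\<exists>E. gauge_ent X \<E> E \<and>
        (\<forall>A. A \<subseteq> X \<and> (\<exists>E'\<in>\<E>. ebounded E' A) \<longrightarrow>
           (\<exists>A'\<in>msets M. A \<subseteq> A' \<and> A' \<subseteq> rimg E A)))"

definition discrete_module ::
    "'x set \<Rightarrow> 'x rel set \<Rightarrow> ('x, 'h::complex_hilbert) cmodule \<Rightarrow> bool" where
  "discrete_module X \<E> M \<longleftrightarrow>
     (\<exists>E P. gauge_ent X \<E> E \<and> partition_on X P \<and>
        (\<forall>A\<in>P. A \<in> msets M \<and> ebounded E A) \<and>
        (\<forall>v\<in>hilb M. ((\<lambda>A. ind M A v) has_sum v) P) \<and>
        (\<forall>C. C \<subseteq> X \<and> (\<forall>A\<in>P. C \<inter> A \<in> msets M) \<longrightarrow> C \<in> msets M))"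

definition faithful_module ::
    "'x set \<Rightarrow> 'x rel set \<Rightarrow> ('x, 'h::complex_hilbert) cmodule \<Rightarrow> bool" where
  "faithful_module X \<E> M \<longleftrightarrow>
     (\<exists>E. gauge_ent X \<E> E \<and>
        coarsely_dense X \<E>
          (\<Union> {A \<in> msets M. ebounded E A \<and> (\<exists>v\<in>hilb M. ind M A v \<noteq> 0)}))"

definition submodule ::
    "'x set \<Rightarrow> 'x rel set \<Rightarrow> ('x, 'h::complex_hilbert) cmodule \<Rightarrow> ('x, 'h) cmodule \<Rightarrow> bool" where
  "submodule X \<E> N M \<longleftrightarrow>
     coarse_module X \<E> N \<and> coarse_module X \<E> M \<and>
     msets N \<subseteq> msets M \<and> hilb N \<subseteq> hilb M \<and>
     (\<forall>A\<in>msets N. \<forall>v\<in>hilb N. ind N A v = ind M A v)"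

definition controlled_propagation ::
    "('x, 'h::complex_hilbert) cmodule \<Rightarrow> 'x rel \<Rightarrow> ('h \<Rightarrow> 'h) \<Rightarrow> bool" where
  "controlled_propagation M E t \<longleftrightarrow>
     bounded_op (hilb M) (hilb M) t \<and>
     (\<forall>A\<in>msets M. \<forall>A'\<in>msets M. A' \<inter> rimg E A = {} \<longrightarrow>
        (\<forall>v\<in>hilb M. ind M A' (t (ind M A v)) = 0))"

definition quasi_local ::
    "('y, 'k::complex_hilbert) cmodule \<Rightarrow> real \<Rightarrow> 'y rel \<Rightarrow> ('k \<Rightarrow> 'k) \<Rightarrow> bool" where
  "quasi_local M \<epsilon> F s \<longleftrightarrow>
     bounded_op (hilb M) (hilb M) s \<and>
     (\<forall>B\<in>msets M. \<forall>B'\<in>msets M. B' \<inter> rimg F B = {} \<longrightarrow>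
        onorm_on (hilb M) (ind M B' \<circ> s \<circ> ind M B) \<le> \<epsilon>)"

definition weakly_quasi_controlled ::
    "'x rel set \<Rightarrow> 'y rel set \<Rightarrow> ('x, 'h::complex_hilbert) cmodule \<Rightarrow>
     ('y, 'k::complex_hilbert) cmodule \<Rightarrow> ('h \<Rightarrow> 'k) \<Rightarrow> bool" where
  "weakly_quasi_controlled \<E> \<F> M N S \<longleftrightarrow>
     (\<forall>E\<in>\<E>. \<forall>\<epsilon>>0. \<exists>F\<in>\<F>. \<forall>t. controlled_propagation M E t \<longrightarrow>
        quasi_local N (\<epsilon> * onorm_on (hilb M) t) F (S \<circ> t \<circ> adj_on (hilb M) S))"

definition approx_rel ::
    "('x, 'h::complex_hilbert) cmodule \<Rightarrow> ('y, 'k::complex_hilbert) cmodule \<Rightarrow>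
     ('h \<Rightarrow> 'k) \<Rightarrow> real \<Rightarrow> 'y rel \<Rightarrow> 'x rel \<Rightarrow> ('y \<times> 'x) set" where
  "approx_rel M N S \<delta> F E =
     \<Union> {B \<times> A | B A. B \<in> msets N \<and> ebounded F B \<and> A \<in> msets M \<and> ebounded E A \<and>
           onorm_on (hilb M) (ind N B \<circ> S \<circ> ind M A) > \<delta>}"

end

theory Submission
  imports Defs
begin

text \<open>The relations \<open>f\<close> and \<open>g\<close> are transposes of each other, since the operators defining them are
  adjoint. So it suffices that \<open>f\<close> and \<open>g\<close> are controlled and that their projections are coarsely
  dense. Control results from weak quasi-control applied to rank-one operators \<open>\<bar>v'\<rangle>\<langle>v\<bar>\<close>, where
  \<open>v\<close> and \<open>v'\<close> have bounded supports, which for near supports are of controlled propagation.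

  For density let \<open>v\<close> be a unit vector of \<open>p\<^sub>X\<^sup>0\<close> supported on a bounded set \<open>A\<close>, and let
  \<open>w = p'\<^sub>Y T v\<close>, a vector of norm at least \<open>\<eta> - \<mu>\<close>. For every union \<open>C\<close> of blocks of \<open>p'\<^sub>Y\<close> the
  vector \<open>T\<^sup>* 1\<^sub>C w\<close> almost lives on a neighbourhood \<open>D\<close> of \<open>A\<close>. Choosing signs for the
  blocks \<open>B\<close>, one gets that \<open>\<Sum>\<^sub>B \<parallel>(1 - 1\<^sub>D) T\<^sup>* 1\<^sub>B w\<parallel>\<^sup>2\<close> is small, hence that
  \<open>(1 - 1\<^sub>D) T\<^sup>* 1\<^sub>B w\<close> is small relative to \<open>1\<^sub>B w\<close> for most blocks. Because \<open>T\<close> maps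
  \<open>1\<^sub>D p''\<^sub>X T\<^sup>* 1\<^sub>B w\<close> to a vector with a large component on \<open>B\<close>, weak quasi-control of \<open>T\<close> (on rank-one
  operators over \<open>D\<close>) forces these blocks to be uniformly close to each other: their union is a
  bounded set carrying almost all of \<open>w\<close>.\<close>

section \<open>Complex Hilbert spaces\<close>

lemma cinner_add_right: "cinner x (y + z) = cinner x y + cinner x z"
  by (metis cinner_add_left cinner_commute complex_cnj_add)

lemma cinner_scaleC_right: "cinner x (c *\<^sub>C y) = c * cinner x y"
  by (metis cinner_commute cinner_scaleC_left complex_cnj_cnj complex_cnj_mult)

lemma cinner_diff_left: "cinner (x - y) z = cinner x z - cinner y z"
  by (metis add_diff_cancel cinner_add_left diff_add_cancel)

lemma cinner_diff_right: "cinner x (y - z) = cinner x y - cinner x z"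
  by (metis add_diff_cancel cinner_add_right diff_add_cancel)

lemma cinner_zero_left [simp]: "cinner 0 x = 0"
  by (metis cinner_diff_left diff_self)

lemma cinner_zero_right [simp]: "cinner x 0 = 0"
  by (metis cinner_diff_right diff_self)

lemma cinner_self: "cinner x x = complex_of_real ((norm x)\<^sup>2)"
proof (rule complex_eqI)
  show "Re (cinner x x) = Re (complex_of_real ((norm x)\<^sup>2))"
    by (simp flip: inner_eq_Re_cinner add: power2_norm_eq_inner)
  have "Im (cinner x x) = - Im (cinner x x)"
    by (metis cinner_commute cnj.simps(2))
  then show "Im (cinner x x) = Im (complex_of_real ((norm x)\<^sup>2))"
    by simp
qed

text \<open>The norm comes with the real structure, so its behaviour under complex scalars is read
  off from the form at \<open>c *\<^sub>C x\<close>.\<close>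

lemma norm_scaleC: "norm (c *\<^sub>C x) = norm c * norm (x :: 'a::complex_hilbert)"
proof -
  have "norm (cinner (c *\<^sub>C x) (c *\<^sub>C x)) = norm (cnj c * (c * cinner x x))"
    by (simp add: cinner_scaleC_left cinner_scaleC_right mult_ac)
  then have "(norm (c *\<^sub>C x))\<^sup>2 = (norm c * norm x)\<^sup>2"
    by (simp only: cinner_self norm_mult norm_of_real complex_mod_cnj)
       (simp add: power2_eq_square mult_ac)
  then show ?thesis
    by (metis norm_ge_zero power2_eq_iff_nonneg zero_le_mult_iff)
qed

text \<open>Scaling \<open>x\<close> by the value \<open>?c\<close> of the form makes the form real
  and nonnegative, and the real Cauchy-Schwarz inequality applies.\<close>

lemma norm_cinner_le: "norm (cinner x y) \<le> norm x * norm y"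
proof -
  let ?c = "cinner x y"
  have "(norm ?c)\<^sup>2 = inner (?c *\<^sub>C x) y"
    by (simp add: inner_eq_Re_cinner cinner_scaleC_left cmod_power2) (simp add: power2_eq_square)
  also have "\<dots> \<le> norm ?c * norm x * norm y"
    using norm_cauchy_schwarz[of "?c *\<^sub>C x" y] by (simp add: norm_scaleC)
  finally show ?thesis
    by (cases "?c = 0") (auto simp: power2_eq_square mult.assoc)
qed

text \<open>The scalar 1 recovers the real part of the form and the scalar \<open>\<i>\<close> its
  imaginary part.\<close>

lemma cinner_eq_of_inner_eq:
  assumes "\<And>c. inner (c *\<^sub>C x) y = inner (c *\<^sub>C x') y'"
  shows "cinner x y = cinner x' y'"
  using assms[of 1] assms[of \<i>]
  by (simp add: complex_eq_iff inner_eq_Re_cinner cinner_scaleC_left)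

section \<open>Closed subspaces, Riesz representation and adjoints\<close>

lemma closed_csubspaceD:
  assumes "closed_csubspace H"
  shows "closed H" "0 \<in> H" "x \<in> H \<Longrightarrow> y \<in> H \<Longrightarrow> x + y \<in> H" "x \<in> H \<Longrightarrow> c *\<^sub>C x \<in> H"
    "x \<in> H \<Longrightarrow> y \<in> H \<Longrightarrow> x - y \<in> H" "x \<in> H \<Longrightarrow> r *\<^sub>R x \<in> H"
  using assms unfolding closed_csubspace_def
  by (auto intro: cvec.subspace_0 cvec.subspace_add cvec.subspace_scale cvec.subspace_diff
      simp: scaleR_scaleC)

text \<open>Minimise \<open>\<parallel>z\<parallel>\<^sup>2 - 2 \<phi> z\<close>: by the parallelogram law minimising sequences are Cauchy, and the
  vanishing of the derivative at the minimum is the representing property.\<close>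

lemma riesz_real:
  fixes \<phi> :: "'a::{real_inner, complete_space} \<Rightarrow> real"
  assumes H: "closed H" "0 \<in> H" "\<And>x y. x \<in> H \<Longrightarrow> y \<in> H \<Longrightarrow> x + y \<in> H"
      "\<And>r x. x \<in> H \<Longrightarrow> r *\<^sub>R x \<in> H"
    and add: "\<And>x y. x \<in> H \<Longrightarrow> y \<in> H \<Longrightarrow> \<phi> (x + y) = \<phi> x + \<phi> y"
    and scale: "\<And>r x. x \<in> H \<Longrightarrow> \<phi> (r *\<^sub>R x) = r * \<phi> x"
    and bound: "\<And>x. x \<in> H \<Longrightarrow> \<bar>\<phi> x\<bar> \<le> C * norm x"
  obtains z where "z \<in> H" "\<And>x. x \<in> H \<Longrightarrow> \<phi> x = inner x z"
proof -
  define J where "J z = (norm z)\<^sup>2 - 2 * \<phi> z" for z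
  define m where "m = Inf (J ` H)"
  have J_ge: "- C\<^sup>2 \<le> J z" if "z \<in> H" for z
  proof -
    have "2 * \<phi> z \<le> 2 * (C * norm z)" using bound[OF that] by linarith
    moreover have "0 \<le> (norm z - C)\<^sup>2" by simp
    ultimately show ?thesis by (simp add: J_def power2_diff mult.commute)
  qed
  then have bdd: "bdd_below (J ` H)" by (auto intro!: bdd_belowI)
  have m_le: "m \<le> J z" if "z \<in> H" for z
    unfolding m_def using that bdd by (auto intro: cInf_lower)
  have "\<exists>z\<in>H. J z < m + 1 / real (Suc n)" for n
  proof -
    have "m < m + 1 / real (Suc n)" by simp
    then show ?thesis
      using cInf_lessD[of "J ` H" "m + 1 / real (Suc n)"] H(2) unfolding m_def by auto
  qed
  then obtain a where a: "\<And>n. a n \<in> H" "\<And>n. J (a n) < m + 1 / real (Suc n)" by metis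
  have dist: "(norm (x - y))\<^sup>2 \<le> 2 * (J x - m) + 2 * (J y - m)" if "x \<in> H" "y \<in> H" for x y
  proof -
    have "m \<le> J ((1/2) *\<^sub>R (x + y))" by (intro m_le H that)
    also have "\<dots> = (norm (x + y))\<^sup>2 / 4 - \<phi> x - \<phi> y"
      unfolding J_def using that H scale[of "x + y" "1/2"] add[of x y]
      by (simp add: power_divide)
    moreover have "(norm (x - y))\<^sup>2 = 2 * (norm x)\<^sup>2 + 2 * (norm y)\<^sup>2 - (norm (x + y))\<^sup>2"
      by (simp add: power2_norm_eq_inner inner_add inner_diff inner_commute)
    ultimately show ?thesis
      unfolding J_def by argo
  qed
  have "Cauchy a"
  proof (rule metric_CauchyI)
    fix e :: real assume "e > 0"
    obtain N where N: "1 / real (Suc N) < e\<^sup>2 / 4"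
      using nat_approx_posE[of "e\<^sup>2/4"] \<open>e > 0\<close> by auto
    have "dist (a k) (a l) < e" if "k \<ge> N" "l \<ge> N" for k l
    proof -
      have *: "J (a j) - m < e\<^sup>2 / 4" if "j \<ge> N" for j
      proof -
        have "1 / real (Suc j) \<le> 1 / real (Suc N)" using that by (simp add: frac_le)
        then show ?thesis using a(2)[of j] N by argo
      qed
      have "(norm (a k - a l))\<^sup>2 < e\<^sup>2"
        using dist[OF a(1) a(1), of k l] *[OF that(1)] *[OF that(2)] by argo
      then show ?thesis
        using \<open>e > 0\<close> by (simp add: dist_norm power_less_imp_less_base)
    qed
    then show "\<exists>M. \<forall>k\<ge>M. \<forall>l\<ge>M. dist (a k) (a l) < e" by blast
  qed
  then obtain z where z: "a \<longlonglongrightarrow> z"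
    using Cauchy_convergent convergent_def by blast
  have zH: "z \<in> H" using closed_sequentially[OF H(1)] a(1) z by blast
  have "J z \<le> m"
  proof -
    have C: "\<phi> (a n) - \<phi> z \<le> C * norm (a n - z)" for n
    proof -
      have "a n - z \<in> H" using H(3)[OF a(1) H(4)[OF zH, of "-1"], of n] by simp
      then show ?thesis
        using add[of "a n - z" z] bound[of "a n - z"] zH by auto
    qed
    have lim: "(\<lambda>n. m + 1 / real (Suc n) + 2 * (C * norm (a n - z)) + ((norm z)\<^sup>2 - (norm (a n))\<^sup>2))
        \<longlonglongrightarrow> m + 0 + 2 * (C * norm (z - z)) + ((norm z)\<^sup>2 - (norm z)\<^sup>2)"
      by (intro tendsto_intros z LIMSEQ_Suc[OF lim_1_over_n])
    have "J z \<le> m + 1 / real (Suc n) + 2 * (C * norm (a n - z)) + ((norm z)\<^sup>2 - (norm (a n))\<^sup>2)" for n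
      using C[of n] a(2)[of n] unfolding J_def by linarith
    then show ?thesis
      using LIMSEQ_le_const[OF lim] by simp
  qed
  have "\<phi> x = inner x z" if "x \<in> H" for x
  proof (rule ccontr)
    assume ne: "\<phi> x \<noteq> inner x z"
    define d where "d = \<phi> x - inner x z"
    have x0: "norm x \<noteq> 0"
      using ne bound[OF that] by auto
    \<comment> \<open>This \<open>r\<close> minimises the quadratic
      \<open>r\<^sup>2 * (norm x)\<^sup>2 - 2 * r * d\<close>, the change of \<open>J\<close> from
      \<open>z\<close> to \<open>z + r *\<^sub>R x\<close>; the change is negative there unless
      \<open>d\<close> vanishes.\<close>
    define r where "r = d / (norm x)\<^sup>2"
    have "J z \<le> J (z + r *\<^sub>R x)"
      using \<open>J z \<le> m\<close> m_le[of "z + r *\<^sub>R x"] H zH that by force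
    also have "\<dots> = J z + r\<^sup>2 * (norm x)\<^sup>2 - 2 * r * d"
    proof -
      have "(norm (z + r *\<^sub>R x))\<^sup>2 = (norm z)\<^sup>2 + 2 * r * inner x z + r\<^sup>2 * (norm x)\<^sup>2"
        unfolding power2_norm_eq_inner by (simp add: inner_add inner_commute power2_eq_square)
      then show ?thesis
        unfolding J_def d_def using add[OF zH H(4)[OF that], of r] scale[OF that, of r]
        by (simp add: algebra_simps)
    qed
    also have "\<dots> = J z - d\<^sup>2 / (norm x)\<^sup>2"
      using x0 by (simp add: r_def field_simps power2_eq_square)
    finally show False
      using x0 ne by (simp add: d_def divide_le_0_iff)
  qed
  then show ?thesis using that zH by blast
qed

text \<open>The real part of the pairing is represented by \<open>riesz_real\<close>; complex
  linearity of \<open>f\<close> then recovers the full form. A general \<open>f\<close> yields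
  adjoints, and the inclusion of \<open>H\<close> yields orthogonal projections.\<close>

lemma riesz:
  fixes H :: "'h::complex_hilbert set" and f :: "'h \<Rightarrow> 'k::complex_hilbert"
  assumes H: "closed_csubspace H" and f: "bounded_op H K f"
  obtains z where "z \<in> H" "\<And>x. x \<in> H \<Longrightarrow> cinner (f x) y = cinner x z"
proof -
  note H' = closed_csubspaceD[OF H]
  obtain C where C: "\<And>x. x \<in> H \<Longrightarrow> norm (f x) \<le> C * norm x"
    using f unfolding bounded_op_def by blast
  have add: "f (x + x') = f x + f x'" if "x \<in> H" "x' \<in> H" for x x'
    using f that unfolding bounded_op_def clinear_on_def by blast
  have scale: "f (c *\<^sub>C x) = c *\<^sub>C f x" if "x \<in> H" for c x
    using f that unfolding bounded_op_def clinear_on_def by blast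
  have bnd: "\<bar>inner (f x) y\<bar> \<le> (C * norm y) * norm x" if "x \<in> H" for x
  proof -
    have "\<bar>inner (f x) y\<bar> \<le> norm (f x) * norm y"
      by (rule Cauchy_Schwarz_ineq2)
    also have "\<dots> \<le> (C * norm x) * norm y"
      by (rule mult_right_mono[OF C[OF that]]) simp
    finally show ?thesis by (simp add: mult_ac)
  qed
  obtain z where z: "z \<in> H" "\<And>x. x \<in> H \<Longrightarrow> inner (f x) y = inner x z"
    by (rule riesz_real[of H "\<lambda>x. inner (f x) y" "C * norm y"])
       (use H' add scale bnd in \<open>auto simp: inner_add scaleR_scaleC scale
          cinner_scaleC_left inner_eq_Re_cinner cinner_add_left\<close>)
  have "cinner (f x) y = cinner x z" if "x \<in> H" for x
    by (rule cinner_eq_of_inner_eq)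
       (use z(2) H'(4)[OF that] scale[OF that] in metis)
  with z(1) show ?thesis using that by blast
qed

lemma cinner_separates:
  assumes "closed_csubspace H" "z \<in> H" "z' \<in> H" "\<And>x. x \<in> H \<Longrightarrow> cinner x z = cinner x z'"
  shows "z = z'"
proof -
  have "cinner (z - z') (z - z') = 0"
    using assms(4)[of "z - z'"] closed_csubspaceD(5)[OF assms(1-3)]
    by (simp add: cinner_diff_right)
  then show ?thesis by (simp add: cinner_self)
qed

lemma adj_on_eqI:
  assumes "closed_csubspace H" "z \<in> H" "\<And>x. x \<in> H \<Longrightarrow> cinner (f x) y = cinner x z"
  shows "adj_on H f y = z"
  unfolding adj_on_def
  by (rule the_equality) (use assms in \<open>auto intro: cinner_separates[OF assms(1)]\<close>)

lemma adj_on: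
  assumes "closed_csubspace H" "bounded_op H K f"
  shows "adj_on H f y \<in> H" "x \<in> H \<Longrightarrow> cinner (f x) y = cinner x (adj_on H f y)"
proof -
  obtain z where "z \<in> H" "\<And>x. x \<in> H \<Longrightarrow> cinner (f x) y = cinner x z"
    using riesz[OF assms] by metis
  with adj_on_eqI[OF assms(1) this]
  show "adj_on H f y \<in> H" "x \<in> H \<Longrightarrow> cinner (f x) y = cinner x (adj_on H f y)" by auto
qed

lemma bounded_opD:
  assumes "bounded_op H K f"
  shows "x \<in> H \<Longrightarrow> f x \<in> K" "x \<in> H \<Longrightarrow> y \<in> H \<Longrightarrow> f (x + y) = f x + f y"
    "x \<in> H \<Longrightarrow> f (c *\<^sub>C x) = c *\<^sub>C f x"
  using assms unfolding bounded_op_def clinear_on_def by auto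

lemma bounded_op_diff:
  assumes "closed_csubspace H" "bounded_op H K f" "x \<in> H" "y \<in> H"
  shows "f (x - y) = f x - f y"
  using bounded_opD(2)[OF assms(2), of "x - y" y] closed_csubspaceD(5)[OF assms(1,3,4)] assms(4)
  by simp

lemma bounded_op_zero:
  assumes "closed_csubspace H" "bounded_op H K f"
  shows "f 0 = 0"
  using bounded_op_diff[OF assms, of 0 0] closed_csubspaceD(2)[OF assms(1)] by simp

lemma bounded_op_bound:
  assumes "bounded_op H K f"
  obtains C where "C > 0" "\<And>x. x \<in> H \<Longrightarrow> norm (f x) \<le> C * norm x"
proof -
  obtain C where C: "\<And>x. x \<in> H \<Longrightarrow> norm (f x) \<le> C * norm x"
    using assms unfolding bounded_op_def by blast
  show ?thesis
  proof (rule that[of "max C 1"])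
    fix x assume "x \<in> H"
    show "norm (f x) \<le> max C 1 * norm x"
      by (rule order_trans[OF C[OF \<open>x \<in> H\<close>]]) (auto intro: mult_right_mono)
  qed simp
qed

text \<open>Linearity of \<open>g\<close> follows because \<open>H\<close> separates its own points;
  the bound comes from pairing \<open>g y\<close> with itself, which equals the pairing of
  \<open>f (g y)\<close> with \<open>y\<close>.\<close>

lemma bounded_op_adjoint:
  assumes H: "closed_csubspace H" and K: "closed_csubspace K" and f: "bounded_op H K f"
    and mem: "\<And>y. y \<in> K \<Longrightarrow> g y \<in> H"
    and adj: "\<And>x y. x \<in> H \<Longrightarrow> y \<in> K \<Longrightarrow> cinner (f x) y = cinner x (g y)"
  shows "bounded_op K H g"
proof -
  obtain C where C: "C > 0" "\<And>x. x \<in> H \<Longrightarrow> norm (f x) \<le> C * norm x"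
    using bounded_op_bound[OF f] by metis
  note Ks = closed_csubspaceD[OF K] and Hs = closed_csubspaceD[OF H]
  have "g (y + y') = g y + g y'" if "y \<in> K" "y' \<in> K" for y y'
    by (rule cinner_separates[OF H])
       (use that mem Ks Hs in \<open>auto simp flip: adj simp: cinner_add_right\<close>)
  moreover have "g (c *\<^sub>C y) = c *\<^sub>C g y" if "y \<in> K" for c y
    by (rule cinner_separates[OF H])
       (use that mem Ks Hs in \<open>auto simp flip: adj simp: cinner_scaleC_right\<close>)
  moreover have "norm (g y) \<le> C * norm y" if "y \<in> K" for y
  proof -
    have "(norm (g y))\<^sup>2 = norm (cinner (f (g y)) y)"
      using that mem by (simp add: adj cinner_self norm_power)
    also have "\<dots> \<le> norm (f (g y)) * norm y"
      by (rule norm_cinner_le)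
    also have "\<dots> \<le> C * norm (g y) * norm y"
      using that mem C(2) by (intro mult_right_mono) auto
    finally have "norm (g y) * norm (g y) \<le> norm (g y) * (C * norm y)"
      by (simp add: power2_eq_square mult_ac)
    then show ?thesis
      using C(1) by (cases "g y = 0") auto
  qed
  ultimately show ?thesis
    using mem unfolding bounded_op_def clinear_on_def by blast
qed

section \<open>Orthogonal projections\<close>

lemma oproj_eqI:
  assumes H: "closed_csubspace H" and "y \<in> H" and y: "\<And>z. z \<in> H \<Longrightarrow> cinner x z = cinner y z"
  shows "oproj H x = y"
  unfolding oproj_def
proof (rule the_equality)
  show "y \<in> H \<and> (\<forall>z\<in>H. cinner (x - y) z = 0)"
    using assms by (simp add: cinner_diff_left)
  fix y' assume y': "y' \<in> H \<and> (\<forall>z\<in>H. cinner (x - y') z = 0)"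
  show "y' = y"
  proof (rule cinner_separates[OF H])
    fix z assume "z \<in> H"
    then have "cinner y' z = cinner y z" using y y' by (simp add: cinner_diff_left)
    then show "cinner z y' = cinner z y" by (metis cinner_commute)
  qed (use y' \<open>y \<in> H\<close> in auto)
qed

context
  fixes H :: "'h::complex_hilbert set"
  assumes H: "closed_csubspace H"
begin

lemma oproj_exists: "\<exists>y\<in>H. \<forall>z\<in>H. cinner x z = cinner y z"
proof -
  \<comment> \<open>For the inclusion of \<open>H\<close>, \<open>riesz\<close> represents pairing
    with an arbitrary ambient vector \<open>x\<close> by a vector of \<open>H\<close>, which is the
    projection of \<open>x\<close>.\<close>
  have "bounded_op H UNIV (\<lambda>z. z)"
    unfolding bounded_op_def clinear_on_def by (auto intro!: exI[of _ 1])
  from riesz[OF H this, of x] obtain y where "y \<in> H" "\<And>z. z \<in> H \<Longrightarrow> cinner z x = cinner z y"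
    by metis
  then show ?thesis by (metis cinner_commute)
qed

lemma oproj_mem [simp]: "oproj H x \<in> H"
  using oproj_exists[of x] oproj_eqI[OF H] by metis

lemma cinner_oproj: "z \<in> H \<Longrightarrow> cinner (oproj H x) z = cinner x z"
  using oproj_exists[of x] oproj_eqI[OF H] by metis

lemma cinner_oproj': "z \<in> H \<Longrightarrow> cinner z (oproj H x) = cinner z x"
  by (metis cinner_commute cinner_oproj)

lemma oproj_id: "x \<in> H \<Longrightarrow> oproj H x = x"
  by (rule oproj_eqI[OF H]) auto

lemma oproj_add: "oproj H (x + y) = oproj H x + oproj H y"
  by (rule oproj_eqI[OF H]) (auto simp: closed_csubspaceD[OF H] cinner_add_left cinner_oproj)

lemma oproj_diff: "oproj H (x - y) = oproj H x - oproj H y"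
  by (rule oproj_eqI[OF H]) (auto simp: closed_csubspaceD[OF H] cinner_diff_left cinner_oproj)

lemma oproj_scaleC: "oproj H (c *\<^sub>C x) = c *\<^sub>C oproj H x"
  by (rule oproj_eqI[OF H]) (auto simp: closed_csubspaceD[OF H] cinner_scaleC_left cinner_oproj)

lemma norm_oproj_le: "norm (oproj H x) \<le> norm x"
proof -
  have "(norm (oproj H x))\<^sup>2 = norm (cinner x (oproj H x))"
    using cinner_oproj[of "oproj H x" x] by (metis cinner_self norm_of_real abs_power2 oproj_mem)
  also have "\<dots> \<le> norm x * norm (oproj H x)" by (rule norm_cinner_le)
  finally show ?thesis
    by (cases "oproj H x = 0") (auto simp: power2_eq_square)
qed

lemma cinner_oproj_commute: "cinner (oproj H x) y = cinner x (oproj H y)"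
  by (metis cinner_oproj cinner_oproj' oproj_mem)

end

lemma oproj_oproj:
  assumes "closed_csubspace H" "closed_csubspace K" "H \<subseteq> K"
  shows "oproj H (oproj K x) = oproj H x"
  by (rule oproj_eqI) (use assms in \<open>auto simp: cinner_oproj subset_iff\<close>)

section \<open>Operator norms as suprema of quotients\<close>

lemma quotient_le: "a \<le> C * (r::real) \<Longrightarrow> 0 \<le> r \<Longrightarrow> a / r \<le> max C 0"
  \<comment> \<open>For \<open>r = 0\<close> the quotient is 0 by convention, whence
    \<open>max C 0\<close> in the bound.\<close>
  by (cases "r = 0") (auto simp: pos_divide_le_eq max_def intro: order_trans mult_nonpos_nonneg)

text \<open>The operator norm is a real supremum, meaningless for unbounded quotients, whence the
  boundedness hypotheses.\<close>

lemma norm_le_onorm_on: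
  assumes "\<And>x. x \<in> H \<Longrightarrow> norm (f x) \<le> C * norm x" "x \<in> H"
  shows "norm (f x) \<le> onorm_on H f * norm x"
proof (cases "x = 0")
  case True
  then show ?thesis using assms by fastforce
next
  case False
  have "norm (f y) / norm y \<le> max C 0" if "y \<in> H" for y
    by (rule quotient_le[OF assms(1)[OF that]]) simp
  then have "bdd_above ((\<lambda>x. norm (f x) / norm x) ` H)"
    by (auto intro!: bdd_aboveI[of _ "max C 0"])
  then have "norm (f x) / norm x \<le> onorm_on H f"
    unfolding onorm_on_def by (rule cSUP_upper[OF assms(2)])
  then show ?thesis using False by (simp add: field_simps)
qed

lemma onorm_on_le:
  assumes "H \<noteq> {}" "\<And>x. x \<in> H \<Longrightarrow> norm (f x) \<le> C * norm x" "0 \<le> C"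
  shows "onorm_on H f \<le> C"
  unfolding onorm_on_def
proof (rule cSUP_least[OF assms(1)])
  fix x assume "x \<in> H"
  show "norm (f x) / norm x \<le> C"
    using assms(2)[OF \<open>x \<in> H\<close>] assms(3) by (cases "x = 0") (auto simp: field_simps)
qed

text \<open>Half of the equality of the norms of an operator and its adjoint; applying it in both
  directions gives equality. It rests on pairing \<open>g y\<close> with itself.\<close>

lemma onorm_on_adjoint_le:
  assumes H: "closed_csubspace H" and K: "closed_csubspace K" and f: "bounded_op H K f"
    and mem: "\<And>y. y \<in> K \<Longrightarrow> g y \<in> H"
    and adj: "\<And>x y. x \<in> H \<Longrightarrow> y \<in> K \<Longrightarrow> cinner (f x) y = cinner x (g y)"
  shows "onorm_on K g \<le> onorm_on H f"
proof (rule onorm_on_le)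
  show "K \<noteq> {}" using closed_csubspaceD(2)[OF K] by blast
  obtain C where C: "\<And>x. x \<in> H \<Longrightarrow> norm (f x) \<le> C * norm x"
    using f unfolding bounded_op_def by blast
  have f_le: "norm (f x) \<le> onorm_on H f * norm x" if "x \<in> H" for x
    by (rule norm_le_onorm_on[OF C that])
  show nonneg: "0 \<le> onorm_on H f"
  proof -
    \<comment> \<open>The supremum includes the quotient at the zero vector, which is 0 by the
      convention for division.\<close>
    have "(0::real) \<le> norm (f 0) / norm (0::'a)" by simp
    also have "\<dots> \<le> onorm_on H f"
      unfolding onorm_on_def
    proof (rule cSUP_upper)
      show "0 \<in> H" by (rule closed_csubspaceD(2)[OF H])
      show "bdd_above ((\<lambda>x. norm (f x) / norm x) ` H)"
      proof (rule bdd_aboveI[of _ "max C 0"])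
        fix t assume "t \<in> (\<lambda>x. norm (f x) / norm x) ` H"
        then obtain x where "x \<in> H" "t = norm (f x) / norm x" by blast
        then show "t \<le> max C 0"
          using C[of x] by (auto intro: quotient_le)
      qed
    qed
    finally show ?thesis .
  qed
  fix y assume y: "y \<in> K"
  have "(norm (g y))\<^sup>2 = norm (cinner (f (g y)) y)"
    using y mem by (simp add: adj cinner_self norm_power)
  also have "\<dots> \<le> norm (f (g y)) * norm y" by (rule norm_cinner_le)
  also have "\<dots> \<le> onorm_on H f * norm (g y) * norm y"
    using y mem f_le by (intro mult_right_mono) auto
  finally have "norm (g y) * norm (g y) \<le> norm (g y) * (onorm_on H f * norm y)"
    by (simp add: power2_eq_square mult_ac)
  then show "norm (g y) \<le> onorm_on H f * norm y"
    using nonneg by (cases "g y = 0") auto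
qed

text \<open>Choosing the signs one after the other so that no mixed term is negative.\<close>

lemma exists_signs:
  fixes x :: "'i \<Rightarrow> 'a::real_inner"
  assumes "finite J"
  obtains J' where "J' \<subseteq> J" "(\<Sum>i\<in>J. (norm (x i))\<^sup>2) \<le> (norm (sum x J' - sum x (J - J')))\<^sup>2"
  using assms
proof (induction J arbitrary: thesis rule: finite_induct)
  case empty
  show ?case by (rule empty[of "{}"]) auto
next
  case (insert i J)
  obtain J' where J': "J' \<subseteq> J"
      "(\<Sum>i\<in>J. (norm (x i))\<^sup>2) \<le> (norm (sum x J' - sum x (J - J')))\<^sup>2"
    using insert.IH by metis
  let ?s = "sum x J' - sum x (J - J')"
  have fin: "finite J'" using J' insert(1) finite_subset by blast
  have i: "i \<notin> J'" "insert i J - insert i J' = J - J'" "insert i J - J' = insert i (J - J')"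
    using insert(2) J'(1) by auto
  have sums: "(\<Sum>k\<in>insert i J. (norm (x k))\<^sup>2) = (norm (x i))\<^sup>2 + (\<Sum>k\<in>J. (norm (x k))\<^sup>2)"
    using insert(1,2) by simp
  show ?case
  proof (cases "0 \<le> inner ?s (x i)")
    case True
    have "sum x (insert i J') - sum x (insert i J - insert i J') = ?s + x i"
      using i(1,2) fin by (simp del: Diff_insert2)
    moreover have "(norm (?s + x i))\<^sup>2 = (norm ?s)\<^sup>2 + 2 * inner ?s (x i) + (norm (x i))\<^sup>2"
      by (simp add: power2_norm_eq_inner inner_add inner_commute)
    ultimately have "(\<Sum>k\<in>insert i J. (norm (x k))\<^sup>2)
        \<le> (norm (sum x (insert i J') - sum x (insert i J - insert i J')))\<^sup>2"
      using True J'(2) sums by (simp only:)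
    then show ?thesis using J'(1) by (intro insert.prems[of "insert i J'"]) auto
  next
    case False
    have "sum x J' - sum x (insert i J - J') = ?s - x i"
      using i insert(1,2) by simp
    moreover have "(norm (?s - x i))\<^sup>2 = (norm ?s)\<^sup>2 - 2 * inner ?s (x i) + (norm (x i))\<^sup>2"
      by (simp add: power2_norm_eq_inner inner_diff inner_commute)
    ultimately have "(\<Sum>k\<in>insert i J. (norm (x k))\<^sup>2)
        \<le> (norm (sum x J' - sum x (insert i J - J')))\<^sup>2"
      using False J'(2) sums by (simp only:)
    then show ?thesis using J'(1) by (intro insert.prems[of J']) auto
  qed
qed

lemma bounded_op_sum:
  assumes H: "closed_csubspace H" and f: "bounded_op H K f"
    and fin: "finite J" and x: "\<And>i. i \<in> J \<Longrightarrow> x i \<in> H"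
  shows "(\<Sum>i\<in>J. x i) \<in> H \<and> f (\<Sum>i\<in>J. x i) = (\<Sum>i\<in>J. f (x i))"
  using fin x
  by (induction J rule: finite_induct)
     (simp_all add: closed_csubspaceD[OF H] bounded_op_zero[OF H f] bounded_opD(2)[OF f])

lemma bounded_op_comp:
  assumes f: "bounded_op H K f" and g: "bounded_op K L g"
  shows "bounded_op H L (g \<circ> f)"
proof -
  obtain C D where C: "\<And>x. x \<in> H \<Longrightarrow> norm (f x) \<le> C * norm x"
    and D: "D > 0" "\<And>x. x \<in> K \<Longrightarrow> norm (g x) \<le> D * norm x"
    using bounded_op_bound[OF f] bounded_op_bound[OF g] by metis
  note f' = bounded_opD[OF f] and g' = bounded_opD[OF g]
  have "norm (g (f x)) \<le> (D * C) * norm x" if "x \<in> H" for x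
  proof -
    have "D * norm (f x) \<le> D * (C * norm x)"
      using C[OF that] D(1) by (intro mult_left_mono) auto
    then show ?thesis
      using D(2)[OF f'(1)[OF that]] by (simp add: mult.assoc)
  qed
  then show ?thesis
    using f' g' unfolding bounded_op_def clinear_on_def by (auto simp: image_subset_iff)
qed

lemma bounded_op_oproj:
  assumes "closed_csubspace H" "H \<subseteq> K"
  shows "bounded_op K K (oproj H)"
  using assms norm_oproj_le[OF assms(1)] oproj_mem[OF assms(1)]
  unfolding bounded_op_def clinear_on_def
  by (auto simp: oproj_add oproj_scaleC intro!: exI[of _ 1])

text \<open>Turns each smallness hypothesis of the theorem into a pointwise estimate on the
  submodule. The crude bound \<open>2 * C\<close> only ensures that the supremum is finite.\<close>

lemma onorm_on_oproj_diff_le: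
  assumes T: "bounded_op H K T" and H0: "closed_csubspace H0" "H0 \<subseteq> H" and K1: "closed_csubspace K1"
    and le: "onorm_on H (\<lambda>v. oproj K1 (T (oproj H0 v)) - T (oproj H0 v)) \<le> \<mu>" and v: "v \<in> H0"
  shows "norm (oproj K1 (T v) - T v) \<le> \<mu> * norm v"
proof -
  let ?f = "\<lambda>v. oproj K1 (T (oproj H0 v)) - T (oproj H0 v)"
  obtain C where C: "C > 0" "\<And>x. x \<in> H \<Longrightarrow> norm (T x) \<le> C * norm x"
    using bounded_op_bound[OF T] by metis
  have "norm (?f x) \<le> (2 * C) * norm x" for x
  proof -
    have "norm (?f x) \<le> 2 * norm (T (oproj H0 x))"
      using norm_triangle_ineq4[of "oproj K1 (T (oproj H0 x))" "T (oproj H0 x)"]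
        norm_oproj_le[OF K1, of "T (oproj H0 x)"] by linarith
    also have "\<dots> \<le> 2 * (C * norm (oproj H0 x))"
      using C(2)[of "oproj H0 x"] oproj_mem[OF H0(1)] H0(2) by auto
    also have "\<dots> \<le> 2 * (C * norm x)"
      using C(1) norm_oproj_le[OF H0(1), of x] by simp
    finally show ?thesis by simp
  qed
  then have "norm (?f v) \<le> onorm_on H ?f * norm v"
    by (rule norm_le_onorm_on) (use v H0 in auto)
  also have "\<dots> \<le> \<mu> * norm v" using le by (rule mult_right_mono) simp
  finally show ?thesis using v by (simp add: oproj_id H0)
qed

lemma cinner_sum_right: "cinner x (\<Sum>i\<in>J. y i) = (\<Sum>i\<in>J. cinner x (y i))"
  by (induction J rule: infinite_finite_induct) (simp_all add: cinner_add_right)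

section \<open>Relations between coarse spaces\<close>

lemma rimg_mono: "A \<subseteq> B \<Longrightarrow> rimg E A \<subseteq> rimg E B"
  unfolding rimg_def by blast

lemma gauge_entD: "gauge_ent X \<E> E \<Longrightarrow> E \<in> \<E>"
  by (simp add: gauge_ent_def)

lemma close_rel_sym: "close_rel \<E> \<F> R R' \<Longrightarrow> close_rel \<E> \<F> R' R"
  unfolding close_rel_def by blast

text \<open>The two inclusions produce composites in opposite orders, so the common witnesses are
  the unions of both orders.\<close>

lemma close_rel_trans:
  assumes "coarse_space X \<E>" "coarse_space Y \<F>" "close_rel \<E> \<F> R R'" "close_rel \<E> \<F> R' R''"
  shows "close_rel \<E> \<F> R R''"
proof -
  interpret X: coarse_space X \<E> by fact
  interpret Y: coarse_space Y \<F> by fact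
  obtain E F where EF: "E \<in> \<E>" "F \<in> \<F>" "R \<subseteq> F O R' O E" "R' \<subseteq> F O R O E"
    using assms(3) unfolding close_rel_def by blast
  obtain E' F' where EF': "E' \<in> \<E>" "F' \<in> \<F>" "R' \<subseteq> F' O R'' O E'" "R'' \<subseteq> F' O R' O E'"
    using assms(4) unfolding close_rel_def by blast
  have "R \<subseteq> F O (F' O R'' O E') O E"
    using EF(3) relcomp_mono[OF order_refl relcomp_mono[OF EF'(3) order_refl]] by (rule order_trans)
  then have "R \<subseteq> (F O F') O R'' O (E' O E)" by (simp add: O_assoc)
  then have "R \<subseteq> (F O F' \<union> F' O F) O R'' O (E O E' \<union> E' O E)"
    by (rule order_trans) (intro relcomp_mono Un_upper1 Un_upper2 order_refl)
  moreover have "R'' \<subseteq> F' O (F O R O E) O E'"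
    using EF'(4) relcomp_mono[OF order_refl relcomp_mono[OF EF(4) order_refl]] by (rule order_trans)
  then have "R'' \<subseteq> (F' O F) O R O (E O E')" by (simp add: O_assoc)
  then have "R'' \<subseteq> (F O F' \<union> F' O F) O R O (E O E' \<union> E' O E)"
    by (rule order_trans) (intro relcomp_mono Un_upper1 Un_upper2 order_refl)
  moreover have "E O E' \<union> E' O E \<in> \<E>" "F O F' \<union> F' O F \<in> \<F>"
    using EF EF' by (auto intro: X.comp_closed X.union_closed Y.comp_closed Y.union_closed)
  ultimately show ?thesis unfolding close_rel_def by blast
qed

section \<open>Coarse maps and coarse inverses\<close>

lemma coarse_class_eqI:
  assumes "coarse_space X \<E>" "coarse_space Y \<F>" "close_rel \<E> \<F> R R'"
  shows "coarse_class X \<E> Y \<F> R = coarse_class X \<E> Y \<F> R'"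
proof -
  have "close_rel \<E> \<F> R R'' \<longleftrightarrow> close_rel \<E> \<F> R' R''" for R''
    using close_rel_trans[OF assms(1,2)] assms(3) close_rel_sym by metis
  then show ?thesis unfolding coarse_class_def by simp
qed

text \<open>By density every \<open>x\<close> has a near point \<open>x0\<close> that
  \<open>R\<close> relates to something; \<open>h x\<close> is such a partner of \<open>x0\<close>.
  Thus the graph lies in \<open>R O E\<inverse>\<close>, from which control and closeness
  follow.\<close>

lemma graph_in_coarse_class:
  assumes X: "coarse_space X \<E>" and Y: "coarse_space Y \<F>" and R: "coarse_rel X \<E> Y \<F> R"
  obtains h where "h \<in> X \<rightarrow> Y" "graph_on X h \<in> coarse_class X \<E> Y \<F> R"
proof -
  interpret X: coarse_space X \<E> by fact
  interpret Y: coarse_space Y \<F> by fact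
  have sub: "R \<subseteq> Y \<times> X" and ctrl: "\<And>E. E \<in> \<E> \<Longrightarrow> R O E O R\<inverse> \<in> \<F>"
    using R unfolding coarse_rel_def controlled_rel_def by auto
  obtain E where E: "E \<in> \<E>" "X = rimg E (Range R)"
    using R unfolding coarse_rel_def coarsely_dense_def by blast
  have "\<exists>y. \<exists>x0. (x, x0) \<in> E \<and> (y, x0) \<in> R" if "x \<in> X" for x
    using E(2) that unfolding rimg_def by blast
  then obtain h where h: "\<And>x. x \<in> X \<Longrightarrow> \<exists>x0. (x, x0) \<in> E \<and> (h x, x0) \<in> R" by metis
  have hXY: "h \<in> X \<rightarrow> Y" using h sub by blast
  \<comment> \<open>The diagonals are adjoined so that a single \<open>?F\<close> and a single
    \<open>?E\<close> serve both inclusions of closeness.\<close>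
  let ?G = "graph_on X h" and ?F = "Id_on Y \<union> R O E O R\<inverse>" and ?E = "Id_on X \<union> E\<inverse>"
  have G: "?G \<subseteq> R O E\<inverse>"
    using h unfolding graph_on_def by fastforce
  have F: "?F \<in> \<F>" "?E \<in> \<E>"
    using E(1) by (auto intro: X.transpose_closed X.union_closed Y.union_closed ctrl X.diagonal Y.diagonal)
  have "R \<subseteq> ?F O ?G O ?E"
  proof clarify
    fix y x assume yx: "(y, x) \<in> R"
    then have "x \<in> X" using sub by blast
    \<comment> \<open>The points \<open>y\<close> and \<open>h x\<close> are joined through
      \<open>x\<close> and its near point \<open>x0\<close>, so the pair lies in
      \<open>R O E O R\<inverse>\<close>.\<close>
    then have "(y, h x) \<in> ?F" "(h x, x) \<in> ?G" "(x, x) \<in> ?E"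
      using yx h[of x] unfolding graph_on_def by auto
    then show "(y, x) \<in> ?F O ?G O ?E" by blast
  qed
  moreover have "R O E\<inverse> \<subseteq> Id_on Y O R O E\<inverse>"
    by (intro subrelI) (use sub in \<open>blast intro: relcompI Id_onI\<close>)
  then have "?G \<subseteq> ?F O R O ?E"
    by (rule order_trans[OF G order_trans]) (intro relcomp_mono Un_upper1 Un_upper2 order_refl)
  ultimately have close: "close_rel \<E> \<F> R ?G"
    using F unfolding close_rel_def by blast
  have "?G O E' O ?G\<inverse> \<in> \<F>" if "E' \<in> \<E>" for E'
  proof (rule Y.subset_closed)
    show "R O (E\<inverse> O E' O E) O R\<inverse> \<in> \<F>"
      using that E by (intro ctrl X.comp_closed X.transpose_closed)
    have "?G\<inverse> \<subseteq> E O R\<inverse>" using G by auto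
    then have "?G O E' O ?G\<inverse> \<subseteq> (R O E\<inverse>) O E' O (E O R\<inverse>)"
      by (intro relcomp_mono G order_refl)
    then show "?G O E' O ?G\<inverse> \<subseteq> R O (E\<inverse> O E' O E) O R\<inverse>"
      by (simp add: O_assoc)
  qed
  moreover have "coarsely_dense X \<E> (Range ?G)"
    unfolding coarsely_dense_def
    by (intro conjI bexI[OF _ X.diagonal]) (auto simp: graph_on_def rimg_def)
  moreover have "?G \<subseteq> Y \<times> X" using hXY by (auto simp: graph_on_def)
  ultimately have "coarse_rel X \<E> Y \<F> ?G"
    unfolding coarse_rel_def controlled_rel_def by blast
  with close hXY show ?thesis using that unfolding coarse_class_def by blast
qed

text \<open>The graph of \<open>g \<circ> f\<close> runs along \<open>R\<close> and back along its
  transpose. Control of the transpose makes this graph an entourage, and a function whose graph is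
  an entourage is close to the identity.\<close>

lemma coarse_comp_converse:
  assumes X: "coarse_space X \<E>" and Y: "coarse_space Y \<F>"
    and R: "coarse_rel X \<E> Y \<F> R" and R': "coarse_rel Y \<F> X \<E> (R\<inverse>)"
  shows "coarse_comp X \<E> Y X \<E> (coarse_class Y \<F> X \<E> (R\<inverse>)) (coarse_class X \<E> Y \<F> R)
    = coarse_class X \<E> X \<E> (graph_on X id)"
proof -
  interpret X: coarse_space X \<E> by fact
  interpret Y: coarse_space Y \<F> by fact
  have eq: "coarse_class X \<E> X \<E> (graph_on X (g \<circ> f)) = coarse_class X \<E> X \<E> (graph_on X id)"
    if f: "f \<in> X \<rightarrow> Y" "graph_on X f \<in> coarse_class X \<E> Y \<F> R"
      and g: "g \<in> Y \<rightarrow> X" "graph_on Y g \<in> coarse_class Y \<F> X \<E> (R\<inverse>)" for f g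
  proof (rule coarse_class_eqI[OF X X])
    obtain E F where EF: "E \<in> \<E>" "F \<in> \<F>" "graph_on X f \<subseteq> F O R O E"
      using f unfolding coarse_class_def close_rel_def by blast
    obtain E' F' where EF': "E' \<in> \<E>" "F' \<in> \<F>" "graph_on Y g \<subseteq> E' O R\<inverse> O F'"
      using g unfolding coarse_class_def close_rel_def by blast
    let ?G = "graph_on X (g \<circ> f)"
    have "E' O (R\<inverse> O (F' O F) O R) O E \<in> \<E>"
      using R' EF EF' unfolding coarse_rel_def controlled_rel_def
      by (metis X.comp_closed Y.comp_closed converse_converse)
    moreover have "?G \<subseteq> E' O (R\<inverse> O (F' O F) O R) O E"
    proof
      fix p assume "p \<in> ?G"
      then obtain x where x: "x \<in> X" "p = (g (f x), x)" unfolding graph_on_def by auto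
      then have "(f x, x) \<in> F O R O E" "(g (f x), f x) \<in> E' O R\<inverse> O F'"
        using f(1) EF(3) EF'(3) unfolding graph_on_def by blast+
      then show "p \<in> E' O (R\<inverse> O (F' O F) O R) O E" unfolding x(2) by blast
    qed
    ultimately have G: "?G \<in> \<E>" by (rule X.subset_closed)
    have "?G \<subseteq> (?G \<union> ?G\<inverse>) O graph_on X id O Id_on X"
      by (auto simp: graph_on_def)
    moreover have "graph_on X id \<subseteq> (?G \<union> ?G\<inverse>) O ?G O Id_on X"
    proof
      fix p assume "p \<in> graph_on X id"
      then obtain x where x: "x \<in> X" "p = (x, x)" unfolding graph_on_def by auto
      then have "(x, g (f x)) \<in> ?G\<inverse>" "(g (f x), x) \<in> ?G" "(x, x) \<in> Id_on X"
        unfolding graph_on_def by auto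
      then show "p \<in> (?G \<union> ?G\<inverse>) O ?G O Id_on X" unfolding x(2) by blast
    qed
    ultimately show "close_rel \<E> \<E> ?G (graph_on X id)"
      unfolding close_rel_def using G X.diagonal X.transpose_closed X.union_closed by blast
  qed
  \<comment> \<open>Existence of representing functions keeps the union defining
    \<open>coarse_comp\<close> from being empty.\<close>
  obtain f where "f \<in> X \<rightarrow> Y" "graph_on X f \<in> coarse_class X \<E> Y \<F> R"
    using graph_in_coarse_class[OF X Y R] .
  moreover obtain g where "g \<in> Y \<rightarrow> X" "graph_on Y g \<in> coarse_class Y \<F> X \<E> (R\<inverse>)"
    using graph_in_coarse_class[OF Y X R'] .
  ultimately have "{coarse_class X \<E> X \<E> (graph_on X (g \<circ> f)) | f g. f \<in> X \<rightarrow> Y \<and> g \<in> Y \<rightarrow> X \<and>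
      graph_on X f \<in> coarse_class X \<E> Y \<F> R \<and> graph_on Y g \<in> coarse_class Y \<F> X \<E> (R\<inverse>)}
    = {coarse_class X \<E> X \<E> (graph_on X id)}"
    using eq by blast
  then show ?thesis unfolding coarse_comp_def by simp
qed

text \<open>Reduces the theorem to control and density of a relation and of its transpose.\<close>

lemma coarse_inverses_converse:
  assumes X: "coarse_space X \<E>" and Y: "coarse_space Y \<F>"
    and R: "coarse_rel X \<E> Y \<F> R" and R': "coarse_rel Y \<F> X \<E> (R\<inverse>)"
  shows "coarse_inverses X \<E> Y \<F> (coarse_class X \<E> Y \<F> R) (coarse_class Y \<F> X \<E> (R\<inverse>))"
  unfolding coarse_inverses_def coarse_map_def
  using coarse_comp_converse[OF X Y R R'] coarse_comp_converse[OF Y X R'] R R' by auto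

section \<open>Modules over coarse spaces\<close>

locale cmod =
  fixes X :: "'x set" and \<E> :: "'x rel set" and M :: "('x, 'h::complex_hilbert) cmodule"
  assumes cmod: "coarse_module X \<E> M"
begin

lemma algebra: "algebra X (msets M)"
  using cmod unfolding coarse_module_def by blast

lemma msets_sub: "A \<in> msets M \<Longrightarrow> A \<subseteq> X"
  using algebra unfolding algebra_iff_Un by blast

lemma msets_Diff: "A \<in> msets M \<Longrightarrow> X - A \<in> msets M"
  using algebra unfolding algebra_iff_Un by blast

lemma msets_Int: "A \<in> msets M \<Longrightarrow> B \<in> msets M \<Longrightarrow> A \<inter> B \<in> msets M"
  using algebra unfolding algebra_iff_Int by blast

lemma msets_empty: "{} \<in> msets M"
  using algebra unfolding algebra_iff_Un by blast

lemma closed: "closed_csubspace (hilb M)"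
  using cmod unfolding coarse_module_def by blast

lemmas hilb = closed_csubspaceD(2-)[OF closed]

lemma ind_proj: "A \<in> msets M \<Longrightarrow> projection_on (hilb M) (ind M A)"
  using cmod unfolding coarse_module_def by blast

lemma ind_bounded: "A \<in> msets M \<Longrightarrow> bounded_op (hilb M) (hilb M) (ind M A)"
  using ind_proj unfolding projection_on_def by blast

lemmas ind_mem = bounded_opD(1)[OF ind_bounded]
  and ind_add = bounded_opD(2)[OF ind_bounded]
  and ind_scaleC = bounded_opD(3)[OF ind_bounded]
  and ind_diff = bounded_op_diff[OF closed ind_bounded]

lemma ind_cinner:
  "A \<in> msets M \<Longrightarrow> v \<in> hilb M \<Longrightarrow> w \<in> hilb M \<Longrightarrow> cinner (ind M A v) w = cinner v (ind M A w)"
  using ind_proj unfolding projection_on_def by blast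

lemma ind_Int:
  "A \<in> msets M \<Longrightarrow> A' \<in> msets M \<Longrightarrow> v \<in> hilb M \<Longrightarrow> ind M A (ind M A' v) = ind M (A \<inter> A') v"
  using cmod unfolding coarse_module_def by metis

lemma ind_idem: "A \<in> msets M \<Longrightarrow> v \<in> hilb M \<Longrightarrow> ind M A (ind M A v) = ind M A v"
  using ind_Int[of A A v] by simp

lemma ind_Un:
  "A \<in> msets M \<Longrightarrow> A' \<in> msets M \<Longrightarrow> A \<inter> A' = {} \<Longrightarrow> v \<in> hilb M \<Longrightarrow>
    ind M (A \<union> A') v = ind M A v + ind M A' v"
  using cmod unfolding coarse_module_def by blast

lemma ind_space: "v \<in> hilb M \<Longrightarrow> ind M X v = v"
  using cmod unfolding coarse_module_def by blast

lemma ind_empty: "v \<in> hilb M \<Longrightarrow> ind M {} v = 0"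
  using ind_Un[OF msets_empty msets_empty, of v] by simp

lemma ind_compl:
  assumes "A \<in> msets M" "v \<in> hilb M" shows "ind M (X - A) v = v - ind M A v"
proof -
  have "A \<union> (X - A) = X" using msets_sub[OF assms(1)] by blast
  then show ?thesis
    using ind_Un[OF assms(1) msets_Diff[OF assms(1)] _ assms(2)] ind_space[OF assms(2)]
    by (simp add: algebra_simps)
qed

lemma norm2_ind: "A \<in> msets M \<Longrightarrow> v \<in> hilb M \<Longrightarrow> cinner v (ind M A v) = of_real ((norm (ind M A v))\<^sup>2)"
  using ind_cinner[of A v "ind M A v"] ind_idem[of A v] ind_mem[of A v] by (simp add: cinner_self)

lemma norm_ind_le:
  assumes "A \<in> msets M" "v \<in> hilb M" shows "norm (ind M A v) \<le> norm v"
proof -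
  have "(norm (ind M A v))\<^sup>2 \<le> norm v * norm (ind M A v)"
    using norm_cinner_le[of v "ind M A v"] norm2_ind[OF assms] by (simp add: norm_power)
  then show ?thesis by (cases "ind M A v = 0") (auto simp: power2_eq_square)
qed

lemma ind_sum:
  assumes "finite J" "J \<subseteq> msets M" "disjoint J" "v \<in> hilb M"
  shows "\<Union>J \<in> msets M \<and> ind M (\<Union>J) v = (\<Sum>A\<in>J. ind M A v)"
  using assms
proof (induction J rule: finite_induct)
  case empty
  then show ?case by (simp add: ind_empty msets_empty)
next
  case (insert A J)
  have "A \<inter> \<Union>J = {}"
    using insert.prems(2) insert.hyps(2) by (auto simp: disjoint_def)
  then show ?case
    using insert ind_Un[of A "\<Union>J"] algebra
    by (auto simp: algebra_iff_Un disjoint_def)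
qed

text \<open>Pythagoras: pairing \<open>v\<close> with its cut to a set gives the squared norm of the
  cut, and this pairing is additive in the set.\<close>

lemma norm2_ind_Union:
  assumes "finite J" "J \<subseteq> msets M" "disjoint J" "v \<in> hilb M"
  shows "(norm (ind M (\<Union>J) v))\<^sup>2 = (\<Sum>A\<in>J. (norm (ind M A v))\<^sup>2)"
proof -
  note J = ind_sum[OF assms]
  have "complex_of_real ((norm (ind M (\<Union>J) v))\<^sup>2) = (\<Sum>A\<in>J. cinner v (ind M A v))"
    using J norm2_ind[of "\<Union>J" v] assms(4) by (simp add: cinner_sum_right)
  also have "\<dots> = (\<Sum>A\<in>J. of_real ((norm (ind M A v))\<^sup>2))"
    using assms by (intro sum.cong norm2_ind) auto
  also have "\<dots> = of_real (\<Sum>A\<in>J. (norm (ind M A v))\<^sup>2)"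
    by simp
  finally show ?thesis by (simp only: of_real_eq_iff)
qed

lemma ind_mono:
  assumes "A \<in> msets M" "B \<in> msets M" "A \<subseteq> B" "v \<in> hilb M" "ind M A v = v"
  shows "ind M B v = v"
  using ind_Int[OF assms(2,1,4)] assms(3,5) by (simp add: Int_absorb1)

text \<open>Vector form of quasi-locality; boundedness of \<open>s\<close> makes the supremum in
  \<open>onorm_on\<close> finite.\<close>

lemma quasi_local_le:
  assumes s: "quasi_local M \<epsilon> F s" and B: "B \<in> msets M" "B' \<in> msets M" "B' \<inter> rimg F B = {}"
    and y: "y \<in> hilb M"
  shows "norm (ind M B' (s (ind M B y))) \<le> \<epsilon> * norm y"
proof -
  have bs: "bounded_op (hilb M) (hilb M) s"
    and le: "onorm_on (hilb M) (ind M B' \<circ> s \<circ> ind M B) \<le> \<epsilon>"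
    using s B unfolding quasi_local_def by blast+
  obtain C where C: "C > 0" "\<And>x. x \<in> hilb M \<Longrightarrow> norm (s x) \<le> C * norm x"
    using bounded_op_bound[OF bs] by metis
  have bnd: "norm ((ind M B' \<circ> s \<circ> ind M B) x) \<le> C * norm x" if x: "x \<in> hilb M" for x
  proof -
    have Bx: "ind M B x \<in> hilb M" using B x by (intro ind_mem)
    have "norm (ind M B' (s (ind M B x))) \<le> norm (s (ind M B x))"
      by (intro norm_ind_le B bounded_opD(1)[OF bs] Bx)
    also have "\<dots> \<le> C * norm (ind M B x)" by (rule C(2)[OF Bx])
    also have "\<dots> \<le> C * norm x"
      using C(1) norm_ind_le[OF B(1) x] by (intro mult_left_mono) auto
    finally show ?thesis by simp
  qed
  have "norm ((ind M B' \<circ> s \<circ> ind M B) y)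
      \<le> onorm_on (hilb M) (ind M B' \<circ> s \<circ> ind M B) * norm y"
    by (rule norm_le_onorm_on[OF bnd y])
  also have "\<dots> \<le> \<epsilon> * norm y" using le by (rule mult_right_mono) simp
  finally show ?thesis by simp
qed

end

section \<open>Submodules and blocks of discrete modules\<close>

locale submod = M: cmod X \<E> M for X :: "'x set" and \<E> and M :: "('x, 'h::complex_hilbert) cmodule" +
  fixes N :: "('x, 'h) cmodule"
  assumes sub: "submodule X \<E> N M"
begin

sublocale N: cmod X \<E> N
  by unfold_locales (use sub in \<open>auto simp: submodule_def\<close>)

lemma msets_mono: "A \<in> msets N \<Longrightarrow> A \<in> msets M"
  using sub unfolding submodule_def by blast

lemma hilb_mono: "v \<in> hilb N \<Longrightarrow> v \<in> hilb M"
  using sub unfolding submodule_def by blast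

lemma ind_eq: "A \<in> msets N \<Longrightarrow> v \<in> hilb N \<Longrightarrow> ind N A v = ind M A v"
  using sub unfolding submodule_def by blast

lemma proj_mem: "oproj (hilb N) v \<in> hilb M"
  by (simp add: hilb_mono N.closed)

text \<open>The indicator of a set measurable for \<open>N\<close> is self-adjoint and preserves
  \<open>hilb N\<close>, so it commutes with the projection. For sets measurable only for
  \<open>M\<close> this may fail, which is why later arguments pass to block hulls.\<close>

lemma ind_oproj:
  assumes "A \<in> msets N" "v \<in> hilb M"
  shows "oproj (hilb N) (ind M A v) = ind M A (oproj (hilb N) v)"
proof (rule oproj_eqI[OF N.closed])
  show "ind M A (oproj (hilb N) v) \<in> hilb N"
    using assms N.ind_mem[of A "oproj (hilb N) v"] by (simp add: ind_eq N.closed)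
  fix z assume z: "z \<in> hilb N"
  have "cinner (ind M A v) z = cinner v (ind M A z)"
    using assms z by (intro M.ind_cinner) (auto intro: msets_mono hilb_mono)
  also have "\<dots> = cinner (oproj (hilb N) v) (ind M A z)"
    using assms z N.ind_mem[of A z] by (simp add: cinner_oproj N.closed flip: ind_eq)
  also have "\<dots> = cinner (ind M A (oproj (hilb N) v)) z"
    using assms z by (intro M.ind_cinner[symmetric]) (auto intro: msets_mono hilb_mono proj_mem)
  finally show "cinner (ind M A v) z = cinner (ind M A (oproj (hilb N) v)) z" .
qed

end

lemma submodule_trans: "submodule X \<E> L N \<Longrightarrow> submodule X \<E> N M \<Longrightarrow> submodule X \<E> L M"
  unfolding submodule_def by (auto simp: subset_iff)

text \<open>The blocks of a discrete module, together with the equivalence relation \<open>\<Theta>\<close> whose classes they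
  are; \<open>rimg \<Theta> A\<close> is the union of the blocks meeting \<open>A\<close>.\<close>

locale blocks = cmod X \<E> M for X :: "'x set" and \<E> and M :: "('x, 'h::complex_hilbert) cmodule" +
  fixes P :: "'x set set" and \<Theta> :: "'x rel"
  assumes part: "partition_on X P"
    and has_sum: "v \<in> hilb M \<Longrightarrow> ((\<lambda>A. ind M A v) has_sum v) P"
    and msets_Union: "Q \<subseteq> P \<Longrightarrow> \<Union>Q \<in> msets M"
    and \<Theta>_def: "\<Theta> = (\<Union>A\<in>P. A \<times> A)"
    and \<Theta>: "\<Theta> \<in> \<E>"
begin

lemma hull: "A \<subseteq> X \<Longrightarrow> A \<subseteq> rimg \<Theta> A"
  using part unfolding partition_on_def \<Theta>_def rimg_def by blast

text \<open>Here \<open>A\<close> may be any set: arbitrary unions of blocks are measurable, so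
  hulls supply measurable neighbourhoods.\<close>

lemma hull_msets: "rimg \<Theta> A \<in> msets M"
proof -
  have "rimg \<Theta> A = \<Union>{B\<in>P. B \<inter> A \<noteq> {}}"
    by (auto simp: \<Theta>_def rimg_def)
  then show ?thesis using msets_Union[of "{B\<in>P. B \<inter> A \<noteq> {}}"] by auto
qed

lemma block: "A \<in> P \<Longrightarrow> A \<in> msets M"
  using msets_Union[of "{A}"] by simp

lemma disj: "disjoint P"
  using part by (simp add: partition_on_def)

lemma Union_compl:
  assumes "Q \<subseteq> P" shows "X - \<Union>(P - Q) = \<Union>Q"
proof -
  have "A \<inter> B = {}" if "A \<in> P - Q" "B \<in> Q" for A B
    using disjointD[OF disj, of A B] that assms by auto
  then have "\<Union>(P - Q) \<inter> \<Union>Q = {}" by blast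
  moreover have "X = \<Union>(P - Q) \<union> \<Union>Q"
    using part assms by (auto simp: partition_on_def)
  ultimately show ?thesis by blast
qed

text \<open>Indicators are only finitely additive. The strong sum over blocks replaces countable
  additivity: \<open>v\<close> is approximated by its cut to finitely many blocks.\<close>

lemma norm_Union_le:
  assumes v: "v \<in> hilb M" and Q: "Q \<subseteq> P"
    and fin: "\<And>J. finite J \<Longrightarrow> J \<subseteq> Q \<Longrightarrow> norm (ind M (\<Union>J) v) \<le> c"
  shows "norm (ind M (\<Union>Q) v) \<le> c"
proof (rule field_le_epsilon)
  fix e :: real assume "e > 0"
  have "eventually (\<lambda>J. dist (\<Sum>A\<in>J. ind M A v) v < e) (finite_subsets_at_top P)"
    using has_sum[OF v] \<open>e > 0\<close> unfolding has_sum_def by (rule tendstoD)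
  then obtain J where J: "finite J" "J \<subseteq> P" "dist (\<Sum>A\<in>J. ind M A v) v < e"
    unfolding eventually_finite_subsets_at_top by blast
  have JM: "\<Union>J \<in> msets M" "ind M (\<Union>J) v = (\<Sum>A\<in>J. ind M A v)"
  proof -
    have "J \<subseteq> msets M" "disjoint J"
      using J(2) block disj pairwise_subset by blast+
    from ind_sum[OF J(1) this v]
    show "\<Union>J \<in> msets M" "ind M (\<Union>J) v = (\<Sum>A\<in>J. ind M A v)" by blast+
  qed
  have eq: "\<Union>Q \<inter> \<Union>J = \<Union>(Q \<inter> J)"
  proof
    show "\<Union>Q \<inter> \<Union>J \<subseteq> \<Union>(Q \<inter> J)"
    proof clarify
      fix x A B assume "x \<in> A" "A \<in> Q" "x \<in> B" "B \<in> J"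
      moreover from this have "A = B" using disjointD[OF disj, of A B] Q J(2) by auto
      ultimately show "x \<in> \<Union>(Q \<inter> J)" by blast
    qed
  qed blast
  note QM = msets_Union[OF Q]
  \<comment> \<open>Infinitely many blocks enter only through the small error; the cut to
    \<open>J\<close> leaves the finite family \<open>Q \<inter> J\<close>.\<close>
  have "ind M (\<Union>Q) v = ind M (\<Union>Q) (v - ind M (\<Union>J) v) + ind M (\<Union>(Q \<inter> J)) v"
    unfolding eq[symmetric] ind_Int[OF QM JM(1) v, symmetric]
      ind_diff[OF QM v ind_mem[OF JM(1) v]] by simp
  also have "norm \<dots> \<le> norm (v - ind M (\<Union>J) v) + c"
  proof (intro norm_triangle_mono norm_ind_le QM fin)
    show "v - ind M (\<Union>J) v \<in> hilb M" by (intro hilb v ind_mem JM(1))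
  qed (use J(1) in auto)
  also have "\<dots> \<le> c + e"
    using J(3) by (simp add: JM(2) dist_norm norm_minus_commute)
  finally show "norm (ind M (\<Union>Q) v) \<le> c + e" .
qed

lemma \<Theta>_sym: "(x, y) \<in> \<Theta> \<Longrightarrow> (y, x) \<in> \<Theta>"
  by (auto simp: \<Theta>_def)

lemma hull_square:
  assumes "A \<times> A \<subseteq> E" shows "rimg \<Theta> A \<times> rimg \<Theta> A \<subseteq> \<Theta> O E O \<Theta>"
proof clarify
  fix a b assume "a \<in> rimg \<Theta> A" "b \<in> rimg \<Theta> A"
  then obtain c d where "c \<in> A" "d \<in> A" "(a, c) \<in> \<Theta>" "(b, d) \<in> \<Theta>"
    unfolding rimg_def by blast
  then show "(a, b) \<in> \<Theta> O E O \<Theta>"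
    using assms \<Theta>_sym[of b d] by (intro relcompI[of a c _ b] relcompI[of c d _ b]) auto
qed

end

text \<open>A union of blocks meets each block in all of it or not at all, hence is measurable by
  discreteness. Uniform boundedness of the blocks makes \<open>\<Theta>\<close> an
  entourage.\<close>

lemma discrete_blocks:
  assumes X: "coarse_space X \<E>" and M: "coarse_module X \<E> M" and d: "discrete_module X \<E> M"
  obtains P \<Theta> where "blocks X \<E> M P \<Theta>"
proof -
  interpret M: cmod X \<E> M by unfold_locales fact
  obtain E P where EP: "gauge_ent X \<E> E" "partition_on X P" "\<And>A. A \<in> P \<Longrightarrow> A \<in> msets M"
      "\<And>A. A \<in> P \<Longrightarrow> ebounded E A" "\<And>v. v \<in> hilb M \<Longrightarrow> ((\<lambda>A. ind M A v) has_sum v) P"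
      "\<And>C. C \<subseteq> X \<Longrightarrow> (\<And>A. A \<in> P \<Longrightarrow> C \<inter> A \<in> msets M) \<Longrightarrow> C \<in> msets M"
    using d unfolding discrete_module_def by metis
  have "blocks X \<E> M P (\<Union>A\<in>P. A \<times> A)"
  proof unfold_locales
    fix Q assume Q: "Q \<subseteq> P"
    show "\<Union>Q \<in> msets M"
    proof (rule EP(6))
      show "\<Union>Q \<subseteq> X" using Q EP(2) by (auto simp: partition_on_def)
      fix A assume A: "A \<in> P"
      have "\<Union>Q \<inter> A = A \<or> \<Union>Q \<inter> A = {}"
        using A Q EP(2) unfolding partition_on_def disjoint_def by blast
      then show "\<Union>Q \<inter> A \<in> msets M" using EP(3)[OF A] M.msets_empty by metis
    qed
  next
    have "(\<Union>A\<in>P. A \<times> A) \<subseteq> E" using EP(4) unfolding ebounded_def by blast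
    then show "(\<Union>A\<in>P. A \<times> A) \<in> \<E>"
      using coarse_space.subset_closed[OF X] gauge_entD[OF EP(1)] by blast
  qed (use EP in auto)
  then show ?thesis using that by blast
qed

section \<open>Weakly quasi-controlled operators\<close>

text \<open>The setting is symmetric: \<open>S\<close> is tied to \<open>T\<close> only by the
  pairing, so everything proved here can be used again with the two spaces and the two operators
  exchanged. The faithful submodules enter only in \<open>approx_rel_dense\<close>.\<close>

locale adjoint_pair =
  X: coarse_space X \<E> + Y: coarse_space Y \<F> +
  HX: cmod X \<E> HX + HY: cmod Y \<F> HY +
  pX1: cmod X \<E> pX1 + pX2: cmod X \<E> pX2 + pY1: cmod Y \<F> pY1 + pY2: cmod Y \<F> pY2 +
  X1: submod X \<E> HX pX1 + X2: submod X \<E> HX pX2 + X12: submod X \<E> pX2 pX1 +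
  Y1: submod Y \<F> HY pY1 + Y2: submod Y \<F> HY pY2 + Y12: submod Y \<F> pY2 pY1 +
  BX: blocks X \<E> pX1 PX \<Theta>X + BY: blocks Y \<F> pY1 PY \<Theta>Y
  for X :: "'x set" and \<E> :: "'x rel set" and Y :: "'y set" and \<F> :: "'y rel set"
    and HX pX1 pX2 :: "('x, 'h::complex_hilbert) cmodule"
    and HY pY1 pY2 :: "('y, 'k::complex_hilbert) cmodule"
    and PX \<Theta>X PY \<Theta>Y +
  fixes T :: "'h \<Rightarrow> 'k" and S :: "'k \<Rightarrow> 'h"
  assumes T: "bounded_op (hilb HX) (hilb HY) T"
    and S: "bounded_op (hilb HY) (hilb HX) S"
    and adj: "x \<in> hilb HX \<Longrightarrow> y \<in> hilb HY \<Longrightarrow> cinner (T x) y = cinner x (S y)"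
    and wqcT: "weakly_quasi_controlled \<E> \<F> pX2 HY (T \<circ> oproj (hilb pX2))"
    and wqcS: "weakly_quasi_controlled \<F> \<E> pY2 HX (S \<circ> oproj (hilb pY2))"
begin

abbreviation "QX \<equiv> oproj (hilb pX2)"
abbreviation "QY \<equiv> oproj (hilb pY2)"
abbreviation "PrY \<equiv> oproj (hilb pY1)"

lemmas T_mem = bounded_opD(1)[OF T] and S_mem = bounded_opD(1)[OF S]

lemma adj_on_T: "y \<in> hilb HY \<Longrightarrow> adj_on (hilb pX2) (T \<circ> QX) y = QX (S y)"
  by (rule adj_on_eqI[OF pX2.closed])
     (simp_all add: pX2.closed oproj_id adj X2.hilb_mono cinner_oproj')

lemma adj_on_S: "x \<in> hilb HX \<Longrightarrow> adj_on (hilb pY2) (S \<circ> QY) x = QY (T x)"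
proof (rule adj_on_eqI[OF pY2.closed])
  fix y assume "x \<in> hilb HX" "y \<in> hilb pY2"
  then have "cinner (S y) x = cinner y (T x)"
    using adj[of x y] Y2.hilb_mono by (metis cinner_commute)
  then show "cinner ((S \<circ> QY) y) x = cinner y (QY (T x))"
    using \<open>y \<in> hilb pY2\<close> by (simp add: pY2.closed oproj_id cinner_oproj')
qed (simp add: pY2.closed)

section \<open>Estimates extracted from weak quasi-control\<close>

text \<open>Vectors with near supports cannot both have large images on separated sets. The rank-one
  operator taking \<open>v\<close> towards \<open>v'\<close> has \<open>E\<close>-controlled
  propagation, and one \<open>F\<close> serves all such operators.\<close>

lemma rank_one_separation:
  assumes "E \<in> \<E>" "\<epsilon> > 0"
  obtains F where "F \<in> \<F>"
    "\<And>A A' v v' B B'. \<lbrakk>A \<in> msets pX2; A' \<in> msets pX2; A' \<times> A \<subseteq> E; v \<in> hilb pX2; v' \<in> hilb pX2;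
      ind HX A v = v; ind HX A' v' = v'; B \<in> msets HY; B' \<in> msets HY; B' \<inter> rimg F B = {}\<rbrakk>
      \<Longrightarrow> norm (ind HY B' (T v')) * norm (ind HY B (T v)) \<le> \<epsilon> * norm v * norm v'"
proof -
  obtain F where F: "F \<in> \<F>" "\<And>t. controlled_propagation pX2 E t \<Longrightarrow>
      quasi_local HY (\<epsilon> * onorm_on (hilb pX2) t) F (T \<circ> QX \<circ> t \<circ> adj_on (hilb pX2) (T \<circ> QX))"
    using wqcT assms unfolding weakly_quasi_controlled_def by metis
  show ?thesis
  proof (rule that[OF F(1)])
    fix A A' v v' B B'
    assume A: "A \<in> msets pX2" "A' \<in> msets pX2" "A' \<times> A \<subseteq> E"
      and v: "v \<in> hilb pX2" "v' \<in> hilb pX2" "ind HX A v = v" "ind HX A' v' = v'"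
      and B: "B \<in> msets HY" "B' \<in> msets HY" "B' \<inter> rimg F B = {}"
    have v2: "ind pX2 A v = v" "ind pX2 A' v' = v'"
      using A v by (simp_all add: X2.ind_eq)
    define t where "t x = cinner v x *\<^sub>C v'" for x
    have t_le: "norm (t x) \<le> (norm v * norm v') * norm x" for x
      using mult_right_mono[OF norm_cinner_le[of v x], of "norm v'"]
      by (simp add: t_def norm_scaleC mult_ac)
    have "controlled_propagation pX2 E t"
      unfolding controlled_propagation_def
    proof (intro conjI ballI impI)
      show "bounded_op (hilb pX2) (hilb pX2) t"
        unfolding bounded_op_def clinear_on_def
        using pX2.hilb(3)[OF v(2)] t_le
        by (auto simp: t_def cinner_add_right scaleC_add_left cinner_scaleC_right scaleC_scaleC)
      fix A1 A1' x assume A1: "A1 \<in> msets pX2" "A1' \<in> msets pX2" "A1' \<inter> rimg E A1 = {}"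
        and x: "x \<in> hilb pX2"
      \<comment> \<open>Points in both intersections would form a pair of
        \<open>A' \<times> A\<close>, hence of \<open>E\<close>, and put a point of
        \<open>A1'\<close> into \<open>rimg E A1\<close>.\<close>
      have "A1 \<inter> A = {} \<or> A1' \<inter> A' = {}"
        using A1(3) A(3) unfolding rimg_def by blast
      then have "ind pX2 A1 v = 0 \<or> ind pX2 A1' v' = 0"
        using pX2.ind_Int[OF A1(1) A(1) v(1)] pX2.ind_Int[OF A1(2) A(2) v(2)] v2
          pX2.ind_empty[OF v(1)] pX2.ind_empty[OF v(2)] by auto
      moreover have "cinner v (ind pX2 A1 x) = cinner (ind pX2 A1 v) x"
        using pX2.ind_cinner[OF A1(1) v(1) x] by simp
      ultimately show "ind pX2 A1' (t (ind pX2 A1 x)) = 0"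
        using A1 v by (auto simp: t_def pX2.ind_scaleC)
    qed
    note ql = F(2)[OF this]
    have ot: "onorm_on (hilb pX2) t \<le> norm v * norm v'"
      using pX2.hilb(1) t_le by (intro onorm_on_le) auto
    let ?b = "ind HY B (T v)"
    have vH: "v \<in> hilb HX" "v' \<in> hilb HX" using v X2.hilb_mono by auto
    have b: "?b \<in> hilb HY" using B T_mem vH by (intro HY.ind_mem)
    \<comment> \<open>The operator is tested on \<open>?b\<close> itself, which it sends to
      \<open>T v'\<close> times the squared norm of \<open>?b\<close>. One factor
      \<open>norm ?b\<close> cancels at the end.\<close>
    have "cinner v (QX (S ?b)) = of_real ((norm ?b)\<^sup>2)"
      using v(1) b vH B(1)
      by (simp add: cinner_oproj' pX2.closed HY.norm2_ind T_mem flip: adj)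
    then have "(T \<circ> QX \<circ> t \<circ> adj_on (hilb pX2) (T \<circ> QX)) ?b = of_real ((norm ?b)\<^sup>2) *\<^sub>C T v'"
      using b v(2) vH by (simp add: adj_on_T t_def oproj_scaleC pX2.closed oproj_id bounded_opD(3)[OF T])
    then have "norm (of_real ((norm ?b)\<^sup>2) *\<^sub>C ind HY B' (T v'))
        \<le> (\<epsilon> * onorm_on (hilb pX2) t) * norm ?b"
      using HY.quasi_local_le[OF ql B b] B b T_mem vH
      by (simp add: HY.ind_idem HY.ind_scaleC)
    also have "\<dots> \<le> (\<epsilon> * (norm v * norm v')) * norm ?b"
      using ot assms(2) by (intro mult_right_mono mult_left_mono) auto
    finally have "norm ?b * (norm (ind HY B' (T v')) * norm ?b) \<le> norm ?b * (\<epsilon> * norm v * norm v')"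
      by (simp only: norm_scaleC norm_of_real) (simp add: power2_eq_square mult_ac)
    then show "norm (ind HY B' (T v')) * norm ?b \<le> \<epsilon> * norm v * norm v'"
      using assms(2) by (cases "?b = 0") auto
  qed
qed

text \<open>Cutting to \<open>C\<close> after projecting to \<open>pY1\<close> never leaves a block,
  so it has \<open>\<Theta>Y\<close>-controlled propagation whatever \<open>C\<close> is. Hence weak
  quasi-control of \<open>S\<close> gives one \<open>E\<close> for all \<open>C\<close>, including
  infinite unions of blocks.\<close>

lemma block_cut_propagation:
  assumes "\<epsilon> > 0"
  obtains E where "E \<in> \<E>"
    "\<And>C A A' v. \<lbrakk>C \<in> msets pY1; A \<in> msets HX; A' \<in> msets HX; A' \<inter> rimg E A = {}; v \<in> hilb HX\<rbrakk>
      \<Longrightarrow> norm (ind HX A' (S (ind HY C (PrY (T (ind HX A v)))))) \<le> \<epsilon> * norm v"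
proof -
  obtain E where E: "E \<in> \<E>" "\<And>t. controlled_propagation pY2 \<Theta>Y t \<Longrightarrow>
      quasi_local HX (\<epsilon> * onorm_on (hilb pY2) t) E (S \<circ> QY \<circ> t \<circ> adj_on (hilb pY2) (S \<circ> QY))"
    using wqcS assms BY.\<Theta> unfolding weakly_quasi_controlled_def by metis
  show ?thesis
  proof (rule that[OF E(1)])
    fix C A A' v
    assume C: "C \<in> msets pY1" and A: "A \<in> msets HX" "A' \<in> msets HX" "A' \<inter> rimg E A = {}"
      and v: "v \<in> hilb HX"
    define t where "t y = ind HY C (PrY y)" for y
    have CH: "C \<in> msets HY" using C Y1.msets_mono by blast
    have t_mem1: "t y \<in> hilb pY1" for y
      using pY1.ind_mem[OF C, of "PrY y"] C by (simp add: t_def Y1.ind_eq pY1.closed)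
    then have t_mem: "t y \<in> hilb pY2" for y using Y12.hilb_mono by blast
    have t_le: "norm (t y) \<le> 1 * norm y" for y
      using HY.norm_ind_le[OF CH, of "PrY y"] norm_oproj_le[OF pY1.closed, of y]
      by (simp add: t_def Y1.proj_mem)
    have "controlled_propagation pY2 \<Theta>Y t"
      unfolding controlled_propagation_def
    proof (intro conjI ballI impI)
      show "bounded_op (hilb pY2) (hilb pY2) t"
        unfolding bounded_op_def clinear_on_def
        using t_mem t_le CH
        by (auto simp: t_def oproj_add oproj_scaleC pY1.closed HY.ind_add HY.ind_scaleC Y1.proj_mem
            intro!: exI[of _ 1])
      fix B B' y assume B: "B \<in> msets pY2" "B' \<in> msets pY2" "B' \<inter> rimg \<Theta>Y B = {}"
        and y: "y \<in> hilb pY2"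
      let ?B = "rimg \<Theta>Y B" and ?u = "ind HY B y"
      have BH: "B \<in> msets HY" "B' \<in> msets HY" "?B \<in> msets HY" "?B \<in> msets pY1"
        using B Y2.msets_mono Y1.msets_mono BY.hull_msets by auto
      have yH: "y \<in> hilb HY" using y Y2.hilb_mono by blast
      have u: "?u \<in> hilb HY" using BH yH HY.ind_mem by blast
      \<comment> \<open>The set \<open>B\<close> need not be measurable for \<open>pY1\<close>; its
        block hull is, and the indicator of the hull commutes with \<open>PrY\<close>.\<close>
      have "ind HY ?B ?u = ?u"
        by (rule HY.ind_mono[OF BH(1,3)])
           (use BH(1) u yH BY.hull[OF pY2.msets_sub[OF B(1)]] in \<open>auto simp: HY.ind_idem\<close>)
      then have "PrY ?u = ind HY ?B (PrY ?u)"
        using Y1.ind_oproj[OF BH(4) u] by simp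
      then have "ind HY B' (t ?u) = ind HY B' (ind HY C (ind HY ?B (PrY ?u)))"
        unfolding t_def by simp
      also have "\<dots> = ind HY (B' \<inter> C \<inter> ?B) (PrY ?u)"
        using BH CH by (simp add: HY.ind_Int HY.msets_Int HY.ind_mem Y1.proj_mem Int_assoc)
      also have "B' \<inter> C \<inter> ?B = {}" using B(3) by blast
      finally have "ind HY B' (t ?u) = 0" by (simp add: HY.ind_empty Y1.proj_mem)
      then show "ind pY2 B' (t (ind pY2 B y)) = 0"
        using B y t_mem by (simp add: Y2.ind_eq)
    qed
    note ql = E(2)[OF this]
    have "onorm_on (hilb pY2) t \<le> 1"
      using pY2.hilb(1) t_le by (intro onorm_on_le) auto
    then have "\<epsilon> * onorm_on (hilb pY2) t * norm v \<le> \<epsilon> * 1 * norm v"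
      using assms by (intro mult_right_mono mult_left_mono) auto
    \<comment> \<open>Since \<open>t\<close> starts with \<open>PrY\<close> and ends in
      \<open>hilb pY1\<close>, both projections to \<open>pY2\<close> are absorbed.\<close>
    moreover have "QY (t (QY y)) = t y" for y
      using oproj_oproj[OF pY1.closed pY2.closed, of y] Y12.hilb_mono t_mem
      by (auto simp: oproj_id pY2.closed t_def subset_iff)
    then have "(S \<circ> QY \<circ> t \<circ> adj_on (hilb pY2) (S \<circ> QY)) (ind HX A v) = S (t (T (ind HX A v)))"
      using A v HX.ind_mem by (simp add: adj_on_S)
    ultimately show "norm (ind HX A' (S (ind HY C (PrY (T (ind HX A v)))))) \<le> \<epsilon> * norm v"
      using HX.quasi_local_le[OF ql A v] unfolding t_def by simp
  qed
qed

section \<open>Control of the approximating relations\<close>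

text \<open>The sets defining the relation are measurable only for \<open>HX\<close> and
  \<open>HY\<close>. Enlarging them to block hulls lets indicators commute with \<open>QX\<close>
  and \<open>QY\<close>, so the witness keeps its support; the price is composing the bounds with
  the block relations.\<close>

lemma approx_rel_witness:
  assumes "(y, x) \<in> approx_rel HX HY (QY \<circ> T \<circ> QX) d F E" "0 \<le> d"
  obtains A B v where "A \<in> msets pX1" "B \<in> msets pY1" "x \<in> A" "y \<in> B"
    "A \<times> A \<subseteq> \<Theta>X O E O \<Theta>X" "B \<times> B \<subseteq> \<Theta>Y O F O \<Theta>Y"
    "v \<in> hilb pX2" "ind HX A v = v" "d * norm v < norm (ind HY B (T v))"
proof -
  obtain A B where A: "A \<in> msets HX" "ebounded E A" "x \<in> A"
    and B: "B \<in> msets HY" "ebounded F B" "y \<in> B"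
    and gt: "onorm_on (hilb HX) (ind HY B \<circ> (QY \<circ> T \<circ> QX) \<circ> ind HX A) > d"
    using assms(1) unfolding approx_rel_def by auto
  let ?A = "rimg \<Theta>X A" and ?B = "rimg \<Theta>Y B"
  have AB: "?A \<in> msets pX1" "?B \<in> msets pY1" "A \<subseteq> ?A" "B \<subseteq> ?B"
    using BX.hull_msets BY.hull_msets BX.hull[OF HX.msets_sub] BY.hull[OF HY.msets_sub] A B by auto
  have ABH: "?A \<in> msets HX" "?B \<in> msets HY" "?A \<in> msets pX2" "?B \<in> msets pY2"
    using AB X1.msets_mono Y1.msets_mono X12.msets_mono Y12.msets_mono by auto
  \<comment> \<open>If no vector exceeded \<open>d\<close>, the supremum would be at most
    \<open>d\<close>; this direction uses \<open>0 \<le> d\<close>.\<close>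
  obtain z where z: "z \<in> hilb HX" "d * norm z < norm (ind HY B (QY (T (QX (ind HX A z)))))"
  proof (rule ccontr)
    assume "\<not> thesis"
    with that have "norm ((ind HY B \<circ> (QY \<circ> T \<circ> QX) \<circ> ind HX A) z) \<le> d * norm z"
      if "z \<in> hilb HX" for z using \<open>z \<in> hilb HX\<close> by force
    then have "onorm_on (hilb HX) (ind HY B \<circ> (QY \<circ> T \<circ> QX) \<circ> ind HX A) \<le> d"
      using HX.hilb(1) assms(2) by (intro onorm_on_le) auto
    with gt show False by simp
  qed
  let ?v = "QX (ind HX A z)"
  have Az: "ind HX A z \<in> hilb HX" using A z HX.ind_mem by blast
  have vH: "?v \<in> hilb HX" by (rule X2.proj_mem)
  have TvH: "T ?v \<in> hilb HY" by (rule T_mem[OF vH])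
  have "ind HX ?A (ind HX A z) = ind HX A z"
    using AB A z ABH by (simp add: HX.ind_Int Int_absorb1)
  then have v_A: "ind HX ?A ?v = ?v"
    using X2.ind_oproj[OF ABH(3) Az] by simp
  have "d * norm ?v \<le> d * norm z"
    using norm_oproj_le[OF pX2.closed, of "ind HX A z"] HX.norm_ind_le[OF A(1) z(1)] assms(2)
    by (intro mult_left_mono) auto
  also have "\<dots> < norm (ind HY B (QY (T ?v)))" by (rule z(2))
  \<comment> \<open>Cutting first to the hull allows \<open>QY\<close> to be moved outside and then
    dropped as a contraction.\<close>
  also have "ind HY B (QY (T ?v)) = ind HY B (ind HY ?B (QY (T ?v)))"
    using B AB ABH by (simp add: HY.ind_Int Y2.proj_mem Int_absorb2)
  also have "norm \<dots> \<le> norm (ind HY ?B (QY (T ?v)))"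
    using B(1) ABH by (intro HY.norm_ind_le HY.ind_mem Y2.proj_mem)
  also have "ind HY ?B (QY (T ?v)) = QY (ind HY ?B (T ?v))"
    by (rule Y2.ind_oproj[OF ABH(4) TvH, symmetric])
  also have "norm \<dots> \<le> norm (ind HY ?B (T ?v))"
    by (rule norm_oproj_le[OF pY2.closed])
  finally have "d * norm ?v < norm (ind HY ?B (T ?v))" .
  then show ?thesis
    using that[of ?A ?B ?v] AB A B v_A BX.hull_square[of A E] BY.hull_square[of B F]
    by (auto simp: ebounded_def pX2.closed)
qed

lemma compression_bounded:
  assumes "B \<in> msets HY" "A \<in> msets HX"
  shows "bounded_op (hilb HX) (hilb HY) (ind HY B \<circ> (QY \<circ> T \<circ> QX) \<circ> ind HX A)"
  using X2.hilb_mono Y2.hilb_mono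
  by (intro bounded_op_comp[OF HX.ind_bounded[OF assms(2)]] bounded_op_comp[OF _ HY.ind_bounded[OF assms(1)]]
      bounded_op_comp[OF bounded_op_oproj[OF pX2.closed]]
      bounded_op_comp[OF T bounded_op_oproj[OF pY2.closed]]) auto

text \<open>The two compressions are adjoint. Used for both orders of the spaces, this makes the two
  relations of the theorem transposes of each other.\<close>

lemma onorm_on_compression_le:
  assumes "B \<in> msets HY" "A \<in> msets HX"
  shows "onorm_on (hilb HY) (ind HX A \<circ> (QX \<circ> S \<circ> QY) \<circ> ind HY B)
    \<le> onorm_on (hilb HX) (ind HY B \<circ> (QY \<circ> T \<circ> QX) \<circ> ind HX A)"
proof (rule onorm_on_adjoint_le[OF HX.closed HY.closed compression_bounded[OF assms]])
  fix y assume "y \<in> hilb HY"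
  then show "(ind HX A \<circ> (QX \<circ> S \<circ> QY) \<circ> ind HY B) y \<in> hilb HX"
    using assms by (simp add: HX.ind_mem X2.proj_mem)
  fix x assume "x \<in> hilb HX"
  show "cinner ((ind HY B \<circ> (QY \<circ> T \<circ> QX) \<circ> ind HX A) x) y
      = cinner x ((ind HX A \<circ> (QX \<circ> S \<circ> QY) \<circ> ind HY B) y)"
    using assms \<open>x \<in> hilb HX\<close> \<open>y \<in> hilb HY\<close>
    by (simp add: HX.ind_mem HY.ind_cinner HX.ind_cinner[symmetric] X2.proj_mem Y2.proj_mem
        cinner_oproj_commute[OF pY2.closed] cinner_oproj_commute[OF pX2.closed, symmetric] adj)
qed

lemma approx_rel_sub: "approx_rel HX HY (QY \<circ> T \<circ> QX) d F E \<subseteq> Y \<times> X"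
  using HX.msets_sub HY.msets_sub unfolding approx_rel_def by blast

text \<open>Two related pairs with near points in \<open>X\<close> give witnesses with near supports
  whose images have product of norms above \<open>d\<^sup>2 * norm v * norm v'\<close>. Separation
  with constant \<open>d\<^sup>2\<close> then forces their target sets to be near.\<close>

lemma approx_rel_controlled:
  assumes "E \<in> \<E>" "F \<in> \<F>" "d > 0"
  shows "controlled_rel \<E> \<F> (approx_rel HX HY (QY \<circ> T \<circ> QX) d F E)"
  unfolding controlled_rel_def
proof
  fix E' assume E': "E' \<in> \<E>"
  let ?f = "approx_rel HX HY (QY \<circ> T \<circ> QX) d F E"
  let ?E = "\<Theta>X O E O \<Theta>X" and ?F = "\<Theta>Y O F O \<Theta>Y"
  have EF: "?E \<in> \<E>" "?F \<in> \<F>"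
    using assms BX.\<Theta> BY.\<Theta> by (auto intro: X.comp_closed Y.comp_closed)
  \<comment> \<open>The transpose appears because the separation estimate asks for
    \<open>A' \<times> A\<close>, while \<open>E'\<close> relates \<open>x\<close> to
    \<open>x'\<close>.\<close>
  have "?E O E'\<inverse> O ?E \<in> \<E>"
    by (rule X.comp_closed[OF EF(1) X.comp_closed[OF X.transpose_closed[OF E'] EF(1)]])
  then obtain F' where F': "F' \<in> \<F>"
    "\<And>A A' v v' B B'. \<lbrakk>A \<in> msets pX2; A' \<in> msets pX2; A' \<times> A \<subseteq> ?E O E'\<inverse> O ?E;
      v \<in> hilb pX2; v' \<in> hilb pX2;
      ind HX A v = v; ind HX A' v' = v'; B \<in> msets HY; B' \<in> msets HY; B' \<inter> rimg F' B = {}\<rbrakk>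
      \<Longrightarrow> norm (ind HY B' (T v')) * norm (ind HY B (T v)) \<le> d\<^sup>2 * norm v * norm v'"
    using rank_one_separation[of "?E O E'\<inverse> O ?E" "d\<^sup>2"] assms(3) by (metis zero_less_power)
  show "?f O E' O ?f\<inverse> \<in> \<F>"
  proof (rule Y.subset_closed)
    show "?F O F'\<inverse> O ?F \<in> \<F>"
      by (rule Y.comp_closed[OF EF(2) Y.comp_closed[OF Y.transpose_closed[OF F'(1)] EF(2)]])
    show "?f O E' O ?f\<inverse> \<subseteq> ?F O F'\<inverse> O ?F"
    proof (rule subrelI)
      fix y y' assume "(y, y') \<in> ?f O E' O ?f\<inverse>"
      then obtain x x' where x: "(y, x) \<in> ?f" "(x, x') \<in> E'" "(y', x') \<in> ?f" by auto
      obtain A B v where A: "A \<in> msets pX1" "x \<in> A" "A \<times> A \<subseteq> ?E"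
        and B: "B \<in> msets pY1" "y \<in> B" "B \<times> B \<subseteq> ?F"
        and v: "v \<in> hilb pX2" "ind HX A v = v" "d * norm v < norm (ind HY B (T v))"
        using approx_rel_witness[OF x(1)] assms(3) by (metis less_imp_le)
      obtain A' B' v' where A': "A' \<in> msets pX1" "x' \<in> A'" "A' \<times> A' \<subseteq> ?E"
        and B': "B' \<in> msets pY1" "y' \<in> B'" "B' \<times> B' \<subseteq> ?F"
        and v': "v' \<in> hilb pX2" "ind HX A' v' = v'" "d * norm v' < norm (ind HY B' (T v'))"
        using approx_rel_witness[OF x(3)] assms(3) by (metis less_imp_le)
      have "A' \<times> A \<subseteq> ?E O E'\<inverse> O ?E"
      proof (rule subrelI)
        fix a' a assume "(a', a) \<in> A' \<times> A"
        then have "(a', x') \<in> ?E" "(x', x) \<in> E'\<inverse>" "(x, a) \<in> ?E"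
          using A A' x(2) by blast+
        then show "(a', a) \<in> ?E O E'\<inverse> O ?E" by (metis relcompI)
      qed
      moreover have "(d * norm v') * (d * norm v) < norm (ind HY B' (T v')) * norm (ind HY B (T v))"
        using v(3) v'(3) assms(3) by (intro mult_strict_mono') auto
      then have "\<not> norm (ind HY B' (T v')) * norm (ind HY B (T v)) \<le> d\<^sup>2 * norm v * norm v'"
        by (simp add: power2_eq_square mult_ac)
      ultimately have "B' \<inter> rimg F' B \<noteq> {}"
        using F'(2)[of A A' v v' B B'] A(1) A'(1) B(1) B'(1) v(1,2) v'(1,2)
          X12.msets_mono Y1.msets_mono by blast
      then obtain b b' where b: "b' \<in> B'" "b \<in> B" "(b', b) \<in> F'" unfolding rimg_def by blast
      then have "(y, b) \<in> ?F" "(b, b') \<in> F'\<inverse>" "(b', y') \<in> ?F" using B B' by blast+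
      then show "(y, y') \<in> ?F O F'\<inverse> O ?F" by (metis relcompI)
    qed
  qed
qed


section \<open>Coarse density of the projections\<close>

text \<open>The bound \<open>F\<close> is uniform in \<open>A\<close> and \<open>v\<close>. The set
  \<open>G\<close> collects the blocks whose images under \<open>S\<close> mostly stay near
  \<open>A\<close>: these are pairwise near, and the remaining blocks carry at most \<epsilon> of
  the mass.\<close>

lemma concentration:
  assumes "\<theta> > 0" "\<epsilon> > 0" "E1 \<in> \<E>"
    and below: "\<And>w. w \<in> hilb pY1 \<Longrightarrow> 2 * \<theta> * norm w \<le> norm (QX (S w))"
  obtains F where "F \<in> \<F>"
    "\<And>A v. \<lbrakk>A \<in> msets HX; A \<times> A \<subseteq> E1; v \<in> hilb HX; ind HX A v = v\<rbrakk> \<Longrightarrow>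
      \<exists>G\<in>msets pY1. G \<times> G \<subseteq> F \<and> norm (PrY (T v)) - \<epsilon> * norm v \<le> norm (ind HY G (PrY (T v)))"
proof -
  \<comment> \<open>A signed sum consists of two partial sums, each costing
    \<open>\<epsilon>1 * norm v\<close>; dividing the total by \<theta> leaves
    \<open>\<epsilon> * norm v\<close>.\<close>
  define \<epsilon>1 where "\<epsilon>1 = \<theta> * \<epsilon> / 2"
  have "\<epsilon>1 > 0" using assms by (simp add: \<epsilon>1_def)
  obtain E' where E': "E' \<in> \<E>"
    "\<And>C A A' v. \<lbrakk>C \<in> msets pY1; A \<in> msets HX; A' \<in> msets HX; A' \<inter> rimg E' A = {}; v \<in> hilb HX\<rbrakk>
      \<Longrightarrow> norm (ind HX A' (S (ind HY C (PrY (T (ind HX A v)))))) \<le> \<epsilon>1 * norm v"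
    using block_cut_propagation[OF \<open>\<epsilon>1 > 0\<close>] by metis
  \<comment> \<open>Bounds the block hull of the \<open>E'\<close>-neighbourhood of any
    \<open>E1\<close>-bounded set.\<close>
  define E2 where "E2 = \<Theta>X O (E' O E1 O E'\<inverse>) O \<Theta>X"
  have "E2 \<in> \<E>"
    using E'(1) assms(3) BX.\<Theta> unfolding E2_def by (intro X.comp_closed X.transpose_closed)
  obtain K where K: "K > 0" "\<And>x. x \<in> hilb HY \<Longrightarrow> norm (S x) \<le> K * norm x"
    using bounded_op_bound[OF S] by metis
  \<comment> \<open>Chosen so that the upper bound in \<open>near\<close> below is half of the lower
    bound.\<close>
  define \<epsilon>2 where "\<epsilon>2 = \<theta>^4 / (2 * K\<^sup>2)"
  have "\<epsilon>2 > 0" using assms K by (simp add: \<epsilon>2_def)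
  obtain F' where F': "F' \<in> \<F>"
    "\<And>A A' v v' B B'. \<lbrakk>A \<in> msets pX2; A' \<in> msets pX2; A' \<times> A \<subseteq> E2; v \<in> hilb pX2; v' \<in> hilb pX2;
      ind HX A v = v; ind HX A' v' = v'; B \<in> msets HY; B' \<in> msets HY; B' \<inter> rimg F' B = {}\<rbrakk>
      \<Longrightarrow> norm (ind HY B' (T v')) * norm (ind HY B (T v)) \<le> \<epsilon>2 * norm v * norm v'"
    using rank_one_separation[OF \<open>E2 \<in> \<E>\<close> \<open>\<epsilon>2 > 0\<close>] by metis
  show ?thesis
  proof (rule that)
    show "\<Theta>Y O F' O \<Theta>Y \<in> \<F>"
      using F'(1) BY.\<Theta> by (intro Y.comp_closed)
    fix A v assume A: "A \<in> msets HX" "A \<times> A \<subseteq> E1" and v: "v \<in> hilb HX" "ind HX A v = v"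
    define w where "w = PrY (T v)"
    \<comment> \<open>Unlike the neighbourhood itself, its hull \<open>D\<close> is measurable for
      \<open>pX1\<close> and \<open>pX2\<close>. Below, \<open>z B\<close> is the part of
      \<open>S (q B)\<close> that escapes \<open>D\<close>.\<close>
    define D where "D = rimg \<Theta>X (rimg E' A)"
    define q where "q B = ind HY B w" for B
    define z where "z B = S (q B) - ind HX D (S (q B))" for B
    have w: "w \<in> hilb pY1" "w \<in> hilb HY" by (simp_all add: w_def pY1.closed Y1.proj_mem)
    have D: "D \<in> msets pX1" "D \<in> msets pX2" "D \<in> msets HX"
      using BX.hull_msets X1.msets_mono X12.msets_mono unfolding D_def by blast+
    have DE: "D \<times> D \<subseteq> E2"
      unfolding D_def E2_def
    proof (rule BX.hull_square)
      show "rimg E' A \<times> rimg E' A \<subseteq> E' O E1 O E'\<inverse>"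
      proof clarify
        fix a b assume "a \<in> rimg E' A" "b \<in> rimg E' A"
        then obtain c d where "c \<in> A" "d \<in> A" "(a, c) \<in> E'" "(b, d) \<in> E'"
          unfolding rimg_def by blast
        then show "(a, b) \<in> E' O E1 O E'\<inverse>"
          using A(2) by (intro relcompI[of a c _ b] relcompI[of c d _ b]) auto
      qed
    qed
    have "rimg E' A \<subseteq> X"
      using X.entourage_subset[OF E'(1)] unfolding rimg_def by blast
    then have DA: "(X - D) \<inter> rimg E' A = {}"
      using BX.hull[of "rimg E' A"] unfolding D_def by blast
    have q_mem: "q B \<in> hilb pY1" "q B \<in> hilb HY" if "B \<in> msets pY1" for B
      using pY1.ind_mem[OF that w(1)] w that Y1.hilb_mono by (auto simp: q_def Y1.ind_eq)
    have tail: "norm (S (q C) - ind HX D (S (q C))) \<le> \<epsilon>1 * norm v" if "C \<in> msets pY1" for C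
      using E'(2)[OF that A(1) HX.msets_Diff[OF D(3)] DA v(1)] q_mem[OF that] D
      by (simp add: v(2) HX.ind_compl S_mem q_def w_def)
    \<comment> \<open>Blocks with \<open>q B = 0\<close> are left out: they carry no mass and would
      satisfy the second condition without any information.\<close>
    define good where
      "good = {B\<in>PY. q B \<noteq> 0 \<and> norm (z B) \<le> \<theta> * norm (q B)}"
    let ?G = "\<Union>good" and ?R = "\<Union>(PY - good)"
    have GR: "?G \<in> msets pY1" "?R \<in> msets pY1"
      by (intro BY.msets_Union; auto simp: good_def)+
    have block: "B \<in> msets pY1" "B \<in> msets HY" if "B \<in> PY" for B
      using BY.block[OF that] Y1.msets_mono by auto
    have "norm (ind pY1 ?R w) \<le> \<epsilon> * norm v"
    proof (rule BY.norm_Union_le[OF w(1)])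
      fix J assume J: "finite J" "J \<subseteq> PY - good"
      have J1: "J \<subseteq> msets pY1" "disjoint J"
        using J(2) BY.block BY.disj pairwise_subset by blast+
      have z_ge: "\<theta> * norm (q B) \<le> norm (z B)" if "B \<in> J" for B
        using that J(2) unfolding good_def by (cases "q B = 0") auto
      obtain J' where J': "J' \<subseteq> J"
          "(\<Sum>B\<in>J. (norm (z B))\<^sup>2) \<le> (norm (sum z J' - sum z (J - J')))\<^sup>2"
        using exists_signs[OF J(1)] by metis
      \<comment> \<open>The estimate \<open>tail\<close> holds for every union of blocks, and by
        linearity each partial sum of \<open>z\<close> is the escaping part for such a
        union.\<close>
      have part: "norm (sum z I) \<le> \<epsilon>1 * norm v" if "I \<subseteq> J" for I
      proof -
        have I: "finite I" "I \<subseteq> msets pY1" "disjoint I"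
          using that J(1) J1 finite_subset pairwise_subset by blast+
        note un = pY1.ind_sum[OF I w(1)]
        have qI: "q (\<Union>I) = (\<Sum>B\<in>I. q B)"
          using un I w(1) by (auto simp: q_def simp flip: Y1.ind_eq intro!: sum.cong)
        have "S (q (\<Union>I)) = (\<Sum>B\<in>I. S (q B))"
          unfolding qI using bounded_op_sum[OF HY.closed S I(1), of q] q_mem I(2) by blast
        moreover have "ind HX D (\<Sum>B\<in>I. S (q B)) = (\<Sum>B\<in>I. ind HX D (S (q B)))"
          using bounded_op_sum[OF HX.closed HX.ind_bounded[OF D(3)] I(1), of "\<lambda>B. S (q B)"]
            q_mem I(2) S_mem by blast
        ultimately have "sum z I = S (q (\<Union>I)) - ind HX D (S (q (\<Union>I)))"
          unfolding z_def by (simp add: sum_subtractf)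
        then show ?thesis using tail un by simp
      qed
      have "(\<theta> * norm (ind pY1 (\<Union>J) w))\<^sup>2 = (\<Sum>B\<in>J. (\<theta> * norm (q B))\<^sup>2)"
        using pY1.norm2_ind_Union[OF J(1) J1 w(1)] J1 w(1)
        by (auto simp: power_mult_distrib sum_distrib_left q_def subset_iff Y1.ind_eq intro!: sum.cong)
      also have "\<dots> \<le> (\<Sum>B\<in>J. (norm (z B))\<^sup>2)"
        using z_ge assms(1) by (intro sum_mono power_mono) auto
      also have "\<dots> \<le> (norm (sum z J' - sum z (J - J')))\<^sup>2" by (rule J'(2))
      also have "\<dots> \<le> (\<epsilon>1 * norm v + \<epsilon>1 * norm v)\<^sup>2"
        using part[OF J'(1)] part[of "J - J'"]
        by (intro power_mono order_trans[OF norm_triangle_ineq4] add_mono) auto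
      also have "\<epsilon>1 * norm v + \<epsilon>1 * norm v = \<theta> * (\<epsilon> * norm v)"
        by (simp add: \<epsilon>1_def)
      finally have "\<theta> * norm (ind pY1 (\<Union>J) w) \<le> \<theta> * (\<epsilon> * norm v)"
        by (rule power2_le_imp_le) (use assms in simp)
      then show "norm (ind pY1 (\<Union>J) w) \<le> \<epsilon> * norm v"
        using assms(1) by simp
    qed auto
    moreover have "ind pY1 ?G w = w - ind pY1 ?R w"
      using pY1.ind_compl[OF GR(2) w(1)] BY.Union_compl[of good] by (simp add: good_def)
    ultimately have large: "norm w - \<epsilon> * norm v \<le> norm (ind HY ?G w)"
      using norm_triangle_ineq2[of w "ind pY1 ?R w"] GR w by (simp add: Y1.ind_eq)
    \<comment> \<open>The vector \<open>u\<close> is \<open>QX (S (q B))\<close> cut to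
      \<open>D\<close>. It is supported where the rank-one estimate applies, and \<open>T\<close>
      sends it to a vector with a definite component on \<open>B\<close>.\<close>
    have good_lower: "\<exists>u\<in>hilb pX2. ind HX D u = u \<and> norm u \<le> K * norm (q B) \<and>
        \<theta>\<^sup>2 * norm (q B) \<le> norm (ind HY B (T u))" if B: "B \<in> good" for B
    proof -
      have BP: "B \<in> PY" "norm (z B) \<le> \<theta> * norm (q B)" "q B \<noteq> 0"
        using B unfolding good_def by auto
      note qm = q_mem[OF block(1)[OF BP(1)]]
      define a where "a = QX (S (q B))"
      define u where "u = ind HX D a"
      have am: "a \<in> hilb HX" "a \<in> hilb pX2"
        by (simp_all add: a_def X2.proj_mem pX2.closed)
      have um: "u \<in> hilb pX2" "u \<in> hilb HX"
        using pX2.ind_mem[OF D(2) am(2)] D am X2.hilb_mono by (auto simp: u_def X2.ind_eq)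
      \<comment> \<open>Because \<open>D\<close> is measurable for \<open>pX2\<close>, the
        difference \<open>a - u\<close> is \<open>QX (z B)\<close>. Goodness thus costs only one of
        the two \<theta> in the lower bound for \<open>a\<close>.\<close>
      have "norm (a - u) \<le> norm (z B)"
        using norm_oproj_le[OF pX2.closed, of "z B"] X2.ind_oproj[OF D(2), of "S (q B)"] S_mem[OF qm(2)]
        by (simp add: z_def a_def u_def oproj_diff pX2.closed)
      then have u_ge: "\<theta> * norm (q B) \<le> norm u"
        using below[OF qm(1)] BP(2) norm_triangle_ineq2[of a "a - u"] by (simp add: a_def)
      have "norm u \<le> norm a" unfolding u_def by (rule HX.norm_ind_le[OF D(3) am(1)])
      also have "\<dots> \<le> norm (S (q B))" unfolding a_def by (rule norm_oproj_le[OF pX2.closed])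
      also have "\<dots> \<le> K * norm (q B)" by (rule K(2)[OF qm(2)])
      finally have u_le: "norm u \<le> K * norm (q B)" .
      have Tu: "T u \<in> hilb HY" by (rule T_mem[OF um(2)])
      \<comment> \<open>Moving \<open>S\<close> across the pairing expresses the squared norm of
        \<open>u\<close> through the component of \<open>T u\<close> on \<open>B\<close>, paired
        with \<open>q B\<close>.\<close>
      have "of_real ((norm u)\<^sup>2) = cinner u a"
        using HX.norm2_ind[OF D(3) am(1)] HX.ind_cinner[OF D(3) am(1) am(1)] by (simp add: u_def)
      also have "\<dots> = cinner (T u) (q B)"
        using um qm by (simp add: a_def cinner_oproj' pX2.closed adj)
      also have "q B = ind HY B (q B)"
        using block[OF BP(1)] w by (simp add: q_def HY.ind_idem)
      also have "cinner (T u) \<dots> = cinner (ind HY B (T u)) (q B)"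
        using block[OF BP(1)] Tu qm by (simp add: HY.ind_cinner)
      finally have "(norm u)\<^sup>2 \<le> norm (ind HY B (T u)) * norm (q B)"
        using norm_cinner_le[of "ind HY B (T u)" "q B"] by (metis abs_power2 norm_of_real)
      moreover have "(\<theta> * norm (q B))\<^sup>2 \<le> (norm u)\<^sup>2"
        using u_ge assms(1) by (intro power_mono) auto
      ultimately have "(\<theta>\<^sup>2 * norm (q B)) * norm (q B) \<le> norm (ind HY B (T u)) * norm (q B)"
        by (simp add: power_mult_distrib power2_eq_square mult_ac)
      then have "\<theta>\<^sup>2 * norm (q B) \<le> norm (ind HY B (T u))" using BP(3) by simp
      moreover have "ind HX D u = u" unfolding u_def by (rule HX.ind_idem[OF D(3) am(1)])
      ultimately show ?thesis using um u_le by blast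
    qed
    \<comment> \<open>Separated good blocks would give
      \<open>\<theta>^4 * m \<le> \<theta>^4 * m / 2\<close> with \<open>m\<close> positive.\<close>
    have near: "B' \<inter> rimg F' B \<noteq> {}" if B: "B \<in> good" "B' \<in> good" for B B'
    proof
      assume sep: "B' \<inter> rimg F' B = {}"
      obtain u where u: "u \<in> hilb pX2" "ind HX D u = u" "norm u \<le> K * norm (q B)"
          "\<theta>\<^sup>2 * norm (q B) \<le> norm (ind HY B (T u))" using good_lower[OF B(1)] by blast
      obtain u' where u': "u' \<in> hilb pX2" "ind HX D u' = u'" "norm u' \<le> K * norm (q B')"
          "\<theta>\<^sup>2 * norm (q B') \<le> norm (ind HY B' (T u'))" using good_lower[OF B(2)] by blast
      have BP: "B \<in> PY" "B' \<in> PY" "0 < norm (q B)" "0 < norm (q B')"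
        using B unfolding good_def by auto
      define m where "m = norm (q B') * norm (q B)"
      have "\<theta>^4 * m = (\<theta>\<^sup>2 * norm (q B')) * (\<theta>\<^sup>2 * norm (q B))"
        by (simp add: m_def power_numeral_reduce)
      also have "\<dots> \<le> norm (ind HY B' (T u')) * norm (ind HY B (T u))"
        using u(4) u'(4) by (intro mult_mono) auto
      also have "\<dots> \<le> \<epsilon>2 * norm u * norm u'"
        by (rule F'(2)[OF D(2) D(2) DE u(1) u'(1) u(2) u'(2) block(2)[OF BP(1)] block(2)[OF BP(2)] sep])
      also have "\<dots> \<le> \<epsilon>2 * (K * norm (q B)) * (K * norm (q B'))"
        using u(3) u'(3) \<open>\<epsilon>2 > 0\<close> K(1) by (intro mult_mono mult_left_mono) auto
      also have "\<dots> = \<theta>^4 * m / 2"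
        using K(1) by (simp add: \<epsilon>2_def m_def power2_eq_square)
      finally have "\<theta>^4 * m \<le> 0" by linarith
      moreover have "\<theta>^4 * m > 0" using assms(1) BP by (simp add: m_def)
      ultimately show False by simp
    qed
    have "?G \<times> ?G \<subseteq> \<Theta>Y O F' O \<Theta>Y"
    proof (rule subrelI)
      fix g g' assume "(g, g') \<in> ?G \<times> ?G"
      then obtain B B' where B: "g \<in> B'" "B' \<in> good" "g' \<in> B" "B \<in> good" by blast
      obtain b b' where b: "b' \<in> B'" "b \<in> B" "(b', b) \<in> F'"
        using near[OF B(4,2)] unfolding rimg_def by blast
      have "(g, b') \<in> \<Theta>Y" "(b, g') \<in> \<Theta>Y"
        using B b unfolding BY.\<Theta>_def good_def by blast+
      with b(3) show "(g, g') \<in> \<Theta>Y O F' O \<Theta>Y" by (intro relcompI)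
    qed
    then show "\<exists>G\<in>msets pY1. G \<times> G \<subseteq> \<Theta>Y O F' O \<Theta>Y \<and>
        norm (PrY (T v)) - \<epsilon> * norm v \<le> norm (ind HY G (PrY (T v)))"
      using large GR(1) unfolding w_def by blast
  qed
qed

text \<open>Every bounded set whose indicator is nonzero in \<open>pX0\<close> lies in the
  projection: the image of a nonzero vector supported there concentrates on a bounded set
  \<open>G\<close>. Faithfulness makes these sets dense, and enlarging \<open>E\<close> and
  \<open>F\<close> keeps the witnesses.\<close>

lemma approx_rel_dense:
  assumes X0: "submodule X \<E> pX0 pX1" and faithful: "faithful_module X \<E> pX0"
    and \<mu>: "0 \<le> \<mu>" "\<mu> < \<delta>" "\<delta> < \<eta>"
    and near_T: "\<And>v. v \<in> hilb pX0 \<Longrightarrow> norm (PrY (T v) - T v) \<le> \<mu> * norm v"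
    and near_S: "\<And>w. w \<in> hilb pY1 \<Longrightarrow> norm (QX (S w) - S w) \<le> \<mu> * norm w"
    and below_T: "bounded_below_on (hilb pX1) \<eta> T" and below_S: "bounded_below_on (hilb pY1) \<eta> S"
  obtains E0 F0 where "E0 \<in> \<E>" "F0 \<in> \<F>"
    "\<And>E F. E0 \<subseteq> E \<Longrightarrow> F0 \<subseteq> F \<Longrightarrow>
      coarsely_dense X \<E> (Range (approx_rel HX HY (QY \<circ> T \<circ> QX) (\<delta> - \<mu>) F E))"
proof -
  interpret X01: submod X \<E> pX1 pX0 by unfold_locales fact
  obtain E1 where E1: "gauge_ent X \<E> E1"
    "coarsely_dense X \<E> (\<Union> {A \<in> msets pX0. ebounded E1 A \<and> (\<exists>v\<in>hilb pX0. ind pX0 A v \<noteq> 0)})"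
    using faithful unfolding faithful_module_def by blast
  let ?\<A> = "{A \<in> msets pX0. ebounded E1 A \<and> (\<exists>v\<in>hilb pX0. ind pX0 A v \<noteq> 0)}"
  have E1\<E>: "E1 \<in> \<E>" using E1(1) by (rule gauge_entD)
  \<comment> \<open>Projecting \<open>S w\<close> loses at most \<mu> of its lower bound \<eta>, so
    \<open>concentration\<close> applies with \<open>(\<eta> - \<mu>) / 2\<close> as
    \<theta>.\<close>
  have lower: "2 * ((\<eta> - \<mu>) / 2) * norm w \<le> norm (QX (S w))" if "w \<in> hilb pY1" for w
  proof -
    have "\<eta> * norm w \<le> norm (S w)" using below_S that unfolding bounded_below_on_def by blast
    then show ?thesis
      using near_S[OF that] norm_triangle_sub[of "S w" "QX (S w)"]
      by (simp add: left_diff_distrib norm_minus_commute)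
  qed
  \<comment> \<open>Giving up half of \<open>\<eta> - \<delta>\<close> still leaves a bound strictly
    above \<open>\<delta> - \<mu>\<close>, as the relation demands.\<close>
  obtain F0 where F0: "F0 \<in> \<F>"
    "\<And>A v. \<lbrakk>A \<in> msets HX; A \<times> A \<subseteq> E1; v \<in> hilb HX; ind HX A v = v\<rbrakk> \<Longrightarrow>
      \<exists>G\<in>msets pY1. G \<times> G \<subseteq> F0 \<and>
        norm (PrY (T v)) - (\<eta> - \<delta>) / 2 * norm v \<le> norm (ind HY G (PrY (T v)))"
    using concentration[OF _ _ E1\<E> lower, of "(\<eta> - \<delta>) / 2"] \<mu> by auto
  show ?thesis
  proof (rule that[OF E1\<E> F0(1)])
    fix E F assume EF: "E1 \<subseteq> E" "F0 \<subseteq> F"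
    let ?f = "approx_rel HX HY (QY \<circ> T \<circ> QX) (\<delta> - \<mu>) F E"
    have "A \<subseteq> Range ?f" if A: "A \<in> ?\<A>" for A
    proof -
      obtain v0 where v0: "v0 \<in> hilb pX0" "ind pX0 A v0 \<noteq> 0" using A by blast
      have A0: "A \<in> msets pX0" "A \<times> A \<subseteq> E1" using A by (auto simp: ebounded_def)
      have Am: "A \<in> msets pX1" "A \<in> msets HX"
        using A0 X01.msets_mono X1.msets_mono by auto
      define v where "v = ind pX0 A v0"
      have v: "v \<in> hilb pX0" "v \<noteq> 0" using v0 A0 X01.N.ind_mem by (auto simp: v_def)
      have vm: "v \<in> hilb pX1" "v \<in> hilb pX2" "v \<in> hilb HX"
        using v X01.hilb_mono X12.hilb_mono X1.hilb_mono by auto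
      have "ind pX0 A v = v" using A0 v0 by (simp add: v_def X01.N.ind_idem)
      then have vA: "ind HX A v = v"
        using v vm A0 Am by (simp add: X01.ind_eq X1.ind_eq)
      define w where "w = PrY (T v)"
      obtain G where G: "G \<in> msets pY1" "G \<times> G \<subseteq> F0"
          "norm w - (\<eta> - \<delta>) / 2 * norm v \<le> norm (ind HY G w)"
        using F0(2)[OF Am(2) A0(2) vm(3) vA] unfolding w_def by blast
      have Gm: "G \<in> msets HY" "G \<in> msets pY2"
        using G Y1.msets_mono Y12.msets_mono by auto
      have "(\<eta> - \<mu>) * norm v \<le> norm w"
      proof -
        have "\<eta> * norm v \<le> norm (T v)"
          using below_T vm(1) unfolding bounded_below_on_def by blast
        then show ?thesis
          using near_T[OF v(1)] norm_triangle_sub[of "T v" w]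
          by (simp add: left_diff_distrib norm_minus_commute w_def)
      qed
      then have "(\<delta> - \<mu>) * norm v + (\<eta> - \<delta>) / 2 * norm v \<le> norm (ind HY G w)"
        using G(3) by (simp add: field_simps)
      moreover have "(\<eta> - \<delta>) / 2 * norm v > 0" using \<mu> v by simp
      ultimately have gt: "(\<delta> - \<mu>) * norm v < norm (ind HY G w)" by linarith
      have Tv: "T v \<in> hilb HY" by (rule T_mem[OF vm(3)])
      \<comment> \<open>The relation involves \<open>QY\<close>, not \<open>PrY\<close>. As
        \<open>G\<close> is measurable for \<open>pY1\<close>, \<open>PrY\<close> can be pulled out
        and discarded as a contraction.\<close>
      have "ind HY G w = PrY (ind HY G (QY (T v)))"
        using Y1.ind_oproj[OF G(1) Y2.proj_mem, of "T v"] oproj_oproj[OF pY1.closed pY2.closed, of "T v"]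
          Y12.hilb_mono by (simp add: w_def subset_iff)
      then have gt2: "(\<delta> - \<mu>) * norm v < norm (ind HY G (QY (T v)))"
        using gt norm_oproj_le[OF pY1.closed, of "ind HY G (QY (T v))"]
        by (metis order_less_le_trans)
      let ?g = "ind HY G \<circ> (QY \<circ> T \<circ> QX) \<circ> ind HX A"
      obtain C where "C > 0" and C: "\<And>x. x \<in> hilb HX \<Longrightarrow> norm (?g x) \<le> C * norm x"
        by (rule bounded_op_bound[OF compression_bounded[OF Gm(1) Am(2)]]) (rule that)
      have "norm (?g v) \<le> onorm_on (hilb HX) ?g * norm v"
        by (rule norm_le_onorm_on[OF C vm(3)])
      moreover have "?g v = ind HY G (QY (T v))"
        using vA vm(2) by (simp add: oproj_id pX2.closed)
      ultimately have "norm (ind HY G (QY (T v))) \<le> onorm_on (hilb HX) ?g * norm v"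
        by (simp only:)
      with gt2 have "(\<delta> - \<mu>) * norm v < onorm_on (hilb HX) ?g * norm v"
        by (rule order_less_le_trans)
      then have "onorm_on (hilb HX) ?g > \<delta> - \<mu>"
        using v(2) by simp
      moreover have "ebounded F G" "ebounded E A"
        unfolding ebounded_def using order_trans[OF G(2) EF(2)] order_trans[OF A0(2) EF(1)] .
      ultimately have sub: "G \<times> A \<subseteq> ?f"
        unfolding approx_rel_def using Gm(1) Am(2)
        by (intro Union_upper CollectI exI[of _ G] exI[of _ A] conjI refl)
      \<comment> \<open>An empty \<open>G\<close> would make \<open>G \<times> A\<close> empty, and
        \<open>A\<close> would not be reached.\<close>
      have "G \<noteq> {}"
      proof
        assume "G = {}"
        then have "norm (ind HY G w) = 0" by (simp add: w_def HY.ind_empty Y1.proj_mem)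
        moreover have "0 \<le> (\<delta> - \<mu>) * norm v" using \<mu> by simp
        ultimately show False using gt by linarith
      qed
      then obtain b where "b \<in> G" by blast
      then have "(b, a) \<in> ?f" if "a \<in> A" for a
        using that by (intro subsetD[OF sub] SigmaI)
      then show ?thesis by (intro subsetI RangeI)
    qed
    then have le: "\<Union>?\<A> \<subseteq> Range ?f" by (rule Union_least)
    have fX: "Range ?f \<subseteq> X"
    proof
      fix x assume "x \<in> Range ?f"
      then obtain y where "(y, x) \<in> ?f" by (rule RangeE)
      then show "x \<in> X" by (rule SigmaD2[OF subsetD[OF approx_rel_sub]])
    qed
    obtain E2 where E2: "E2 \<in> \<E>" "X = rimg E2 (\<Union>?\<A>)"
      using E1(2)[unfolded coarsely_dense_def] by (elim conjE bexE) (rule that)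
    have "X \<subseteq> rimg E2 (Range ?f)"
      unfolding E2(2) by (rule rimg_mono[OF le])
    moreover have "rimg E2 D \<subseteq> X" for D
      using X.entourage_subset[OF E2(1)] unfolding rimg_def by blast
    ultimately have "X = rimg E2 (Range ?f)" by (rule equalityI)
    with fX E2(1) show "coarsely_dense X \<E> (Range ?f)"
      unfolding coarsely_dense_def by (intro conjI bexI)
  qed
qed

end

section \<open>Coarse equivalence from both directions together\<close>

theorem theorem4p1:
  fixes X :: "'x set" and \<E> :: "'x rel set"
    and Y :: "'y set" and \<F> :: "'y rel set"
    and HX pX0 pX1 pX2 :: "('x, 'h::complex_hilbert) cmodule"
    and HY pY0 pY1 pY2 :: "('y, 'k::complex_hilbert) cmodule"
    and T :: "'h \<Rightarrow> 'k" and Ts :: "'k \<Rightarrow> 'h"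
    and PX0 PX1 PX2 :: "'h \<Rightarrow> 'h" and PY0 PY1 PY2 :: "'k \<Rightarrow> 'k"
    and \<mu> \<eta> :: real
  defines "Ts \<equiv> adj_on (hilb HX) T"
    and "PX0 \<equiv> oproj (hilb pX0)" and "PX1 \<equiv> oproj (hilb pX1)" and "PX2 \<equiv> oproj (hilb pX2)"
    and "PY0 \<equiv> oproj (hilb pY0)" and "PY1 \<equiv> oproj (hilb pY1)" and "PY2 \<equiv> oproj (hilb pY2)"
  assumes "coarse_space X \<E>" and "coarse_space Y \<F>"
    and "coarse_module X \<E> HX" and "locally_admissible X \<E> HX"
    and "coarse_module Y \<F> HY" and "locally_admissible Y \<F> HY"
    and "bounded_op (hilb HX) (hilb HY) T"
    and "0 \<le> \<mu>" and "\<mu> < \<eta> / 2"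
    and "submodule X \<E> pX0 pX1" and "submodule X \<E> pX1 pX2" and "submodule X \<E> pX2 HX"
    and "submodule Y \<F> pY0 pY1" and "submodule Y \<F> pY1 pY2" and "submodule Y \<F> pY2 HY"
    and "onorm_on (hilb HX) (\<lambda>v. PY1 (T (PX0 v)) - T (PX0 v)) \<le> \<mu>"
    and "onorm_on (hilb HX) (\<lambda>v. PY2 (T (PX1 v)) - T (PX1 v)) \<le> \<mu>"
    and "onorm_on (hilb HY) (\<lambda>w. PX1 (Ts (PY0 w)) - Ts (PY0 w)) \<le> \<mu>"
    and "onorm_on (hilb HY) (\<lambda>w. PX2 (Ts (PY1 w)) - Ts (PY1 w)) \<le> \<mu>"
    and "faithful_module X \<E> pX0" and "faithful_module Y \<F> pY0"
    and "discrete_module X \<E> pX1" and "discrete_module Y \<F> pY1"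
    and "bounded_below_on (hilb pX1) \<eta> T" and "bounded_below_on (hilb pY1) \<eta> Ts"
    and "weakly_quasi_controlled \<E> \<F> pX2 HY (T \<circ> PX2)"
    and "weakly_quasi_controlled \<F> \<E> pY2 HX (Ts \<circ> PY2)"
  shows "\<forall>\<delta>. \<mu> < \<delta> \<and> \<delta> < \<eta> \<longrightarrow>
    (\<exists>E0\<in>\<E>. \<exists>F0\<in>\<F>. \<forall>E\<in>\<E>. \<forall>F\<in>\<F>. E0 \<subseteq> E \<and> F0 \<subseteq> F \<longrightarrow>
      (let f = approx_rel HX HY (PY2 \<circ> T \<circ> PX2) (\<delta> - \<mu>) F E;
           g = approx_rel HY HX (PX2 \<circ> Ts \<circ> PY2) (\<delta> - \<mu>) E F
       in coarse_rel X \<E> Y \<F> f \<and> coarse_rel Y \<F> X \<E> g \<and>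
          coarse_equivalence X \<E> Y \<F> (coarse_class X \<E> Y \<F> f) \<and>
          coarse_inverses X \<E> Y \<F> (coarse_class X \<E> Y \<F> f) (coarse_class Y \<F> X \<E> g)))"
proof (intro allI impI, elim conjE)
  fix \<delta> assume \<delta>: "\<mu> < \<delta>" "\<delta> < \<eta>"
  note X = assms(8) and Y = assms(9) and \<mu> = assms(15)
  have modules: "coarse_module X \<E> pX0" "coarse_module X \<E> pX1" "coarse_module X \<E> pX2"
      "coarse_module Y \<F> pY0" "coarse_module Y \<F> pY1" "coarse_module Y \<F> pY2"
    using assms(17-22) unfolding submodule_def by simp_all
  note sub = submodule_trans[OF assms(18,19)] submodule_trans[OF assms(21,22)]
  have hilb: "hilb pX0 \<subseteq> hilb HX" "hilb pX1 \<subseteq> hilb HX" "hilb pY0 \<subseteq> hilb HY" "hilb pY1 \<subseteq> hilb HY"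
    using sub submodule_trans[OF assms(17) sub(1)] submodule_trans[OF assms(20) sub(2)]
    unfolding submodule_def by simp_all
  have closed: "closed_csubspace (hilb M)" if "coarse_module Z \<G> M"
    for Z :: "'z set" and \<G> and M :: "('z, 'v::complex_hilbert) cmodule"
    using that unfolding coarse_module_def by blast
  note HX = closed[OF assms(10)] and HY = closed[OF assms(12)]
  have Ts_mem: "Ts y \<in> hilb HX" for y
    unfolding Ts_def by (rule adj_on(1)[OF HX assms(14)])
  have adj: "cinner (T x) y = cinner x (Ts y)" if "x \<in> hilb HX" for x y
    unfolding Ts_def by (rule adj_on(2)[OF HX assms(14) that])
  have adj': "cinner (Ts y) x = cinner y (T x)" if "x \<in> hilb HX" for x y
    using adj[OF that, of y] by (metis cinner_commute)
  have Ts: "bounded_op (hilb HY) (hilb HX) Ts"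
    by (rule bounded_op_adjoint[OF HX HY assms(14) Ts_mem adj])
  obtain PX \<Theta>X where BX: "blocks X \<E> pX1 PX \<Theta>X"
    using discrete_blocks[OF X modules(2) assms(29)] .
  obtain PY \<Theta>Y where BY: "blocks Y \<F> pY1 PY \<Theta>Y"
    using discrete_blocks[OF Y modules(5) assms(30)] .
  interpret XY: adjoint_pair X \<E> Y \<F> HX pX1 pX2 HY pY1 pY2 PX \<Theta>X PY \<Theta>Y T Ts
    by (intro adjoint_pair.intro adjoint_pair_axioms.intro submod.intro submod_axioms.intro cmod.intro
        X Y modules sub assms(10,12,14,18,19,21,22) BX BY Ts adj)
       (use assms(33,34) in \<open>simp_all only: PX2_def PY2_def\<close>)
  \<comment> \<open>The same setting with the spaces and the operators exchanged, for the inverse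
    direction.\<close>
  interpret YX: adjoint_pair Y \<F> X \<E> HY pY1 pY2 HX pX1 pX2 PY \<Theta>Y PX \<Theta>X Ts T
    by (intro adjoint_pair.intro adjoint_pair_axioms.intro submod.intro submod_axioms.intro cmod.intro
        X Y modules sub assms(10,12,14,18,19,21,22) BX BY Ts adj')
       (use assms(33,34) in \<open>simp_all only: PX2_def PY2_def\<close>)
  have near_T: "norm (oproj (hilb pY1) (T v) - T v) \<le> \<mu> * norm v" if "v \<in> hilb pX0" for v
    by (rule onorm_on_oproj_diff_le[OF assms(14) closed[OF modules(1)] hilb(1) closed[OF modules(5)] _ that])
       (use assms(23) in \<open>simp only: PX0_def PY1_def\<close>)
  have near_T': "norm (oproj (hilb pY2) (T v) - T v) \<le> \<mu> * norm v" if "v \<in> hilb pX1" for v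
    by (rule onorm_on_oproj_diff_le[OF assms(14) closed[OF modules(2)] hilb(2) closed[OF modules(6)] _ that])
       (use assms(24) in \<open>simp only: PX1_def PY2_def\<close>)
  have near_S: "norm (oproj (hilb pX1) (Ts w) - Ts w) \<le> \<mu> * norm w" if "w \<in> hilb pY0" for w
    by (rule onorm_on_oproj_diff_le[OF Ts closed[OF modules(4)] hilb(3) closed[OF modules(2)] _ that])
       (use assms(25) in \<open>simp only: PX1_def PY0_def\<close>)
  have near_S': "norm (oproj (hilb pX2) (Ts w) - Ts w) \<le> \<mu> * norm w" if "w \<in> hilb pY1" for w
    by (rule onorm_on_oproj_diff_le[OF Ts closed[OF modules(5)] hilb(4) closed[OF modules(3)] _ that])
       (use assms(26) in \<open>simp only: PX2_def PY1_def\<close>)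
  \<comment> \<open>Each direction uses one estimate on the innermost submodule and one on the
    middle submodule of the other space, so the two together use all four.\<close>
  obtain E1 F1 where 1: "E1 \<in> \<E>" "F1 \<in> \<F>" "\<And>E F. E1 \<subseteq> E \<Longrightarrow> F1 \<subseteq> F \<Longrightarrow>
      coarsely_dense X \<E> (Range (approx_rel HX HY (oproj (hilb pY2) \<circ> T \<circ> oproj (hilb pX2)) (\<delta> - \<mu>) F E))"
    by (rule XY.approx_rel_dense[OF assms(17,27) \<mu> \<delta> near_T near_S' assms(31,32)]) (assumption+, rule that)
  obtain F2 E2 where 2: "F2 \<in> \<F>" "E2 \<in> \<E>" "\<And>F E. F2 \<subseteq> F \<Longrightarrow> E2 \<subseteq> E \<Longrightarrow>
      coarsely_dense Y \<F> (Range (approx_rel HY HX (oproj (hilb pX2) \<circ> Ts \<circ> oproj (hilb pY2)) (\<delta> - \<mu>) E F))"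
    by (rule YX.approx_rel_dense[OF assms(20,28) \<mu> \<delta> near_S near_T' assms(32,31)]) (assumption+, rule that)
  show "\<exists>E0\<in>\<E>. \<exists>F0\<in>\<F>. \<forall>E\<in>\<E>. \<forall>F\<in>\<F>. E0 \<subseteq> E \<and> F0 \<subseteq> F \<longrightarrow>
      (let f = approx_rel HX HY (PY2 \<circ> T \<circ> PX2) (\<delta> - \<mu>) F E;
           g = approx_rel HY HX (PX2 \<circ> Ts \<circ> PY2) (\<delta> - \<mu>) E F
       in coarse_rel X \<E> Y \<F> f \<and> coarse_rel Y \<F> X \<E> g \<and>
          coarse_equivalence X \<E> Y \<F> (coarse_class X \<E> Y \<F> f) \<and>
          coarse_inverses X \<E> Y \<F> (coarse_class X \<E> Y \<F> f) (coarse_class Y \<F> X \<E> g))"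
  proof (intro bexI ballI impI)
    \<comment> \<open>Density persists above each threshold, so unions serve both
      directions.\<close>
    show "E1 \<union> E2 \<in> \<E>" "F1 \<union> F2 \<in> \<F>"
      using 1(1,2) 2(1,2) by (auto intro: XY.X.union_closed XY.Y.union_closed)
    fix E F assume EF: "E \<in> \<E>" "F \<in> \<F>" "E1 \<union> E2 \<subseteq> E \<and> F1 \<union> F2 \<subseteq> F"
    define f where "f = approx_rel HX HY (PY2 \<circ> T \<circ> PX2) (\<delta> - \<mu>) F E"
    define g where "g = approx_rel HY HX (PX2 \<circ> Ts \<circ> PY2) (\<delta> - \<mu>) E F"
    have d: "\<delta> - \<mu> > 0" using \<delta> by simp
    have f: "coarse_rel X \<E> Y \<F> f"
      unfolding coarse_rel_def f_def PX2_def PY2_def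
      by (intro conjI XY.approx_rel_sub XY.approx_rel_controlled 1(3) EF(1,2) d) (use EF(3) in auto)
    have g: "coarse_rel Y \<F> X \<E> g"
      unfolding coarse_rel_def g_def PX2_def PY2_def
      by (intro conjI YX.approx_rel_sub YX.approx_rel_controlled 2(3) EF(1,2) d) (use EF(3) in auto)
    \<comment> \<open>Adjoint compressions have equal norms, so the same pairs of sets pass the
      threshold for \<open>f\<close> and for \<open>g\<close>; this gives
      \<open>g = f\<inverse>\<close>.\<close>
    have eq: "onorm_on (hilb HY) (ind HX A \<circ> (PX2 \<circ> Ts \<circ> PY2) \<circ> ind HY B)
        = onorm_on (hilb HX) (ind HY B \<circ> (PY2 \<circ> T \<circ> PX2) \<circ> ind HX A)"
      if "A \<in> msets HX" "B \<in> msets HY" for A B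
      using XY.onorm_on_compression_le[OF that(2,1)] YX.onorm_on_compression_le[OF that]
      unfolding PX2_def PY2_def by (rule antisym)
    have "(x, y) \<in> g \<longleftrightarrow> (y, x) \<in> f" for x y
    proof -
      have "(x, y) \<in> g \<longleftrightarrow> (\<exists>A B. A \<in> msets HX \<and> ebounded E A \<and> B \<in> msets HY \<and> ebounded F B \<and>
          \<delta> - \<mu> < onorm_on (hilb HY) (ind HX A \<circ> (PX2 \<circ> Ts \<circ> PY2) \<circ> ind HY B) \<and> x \<in> A \<and> y \<in> B)"
        unfolding g_def approx_rel_def by auto
      also have "\<dots> \<longleftrightarrow> (\<exists>A B. A \<in> msets HX \<and> ebounded E A \<and> B \<in> msets HY \<and> ebounded F B \<and>
          \<delta> - \<mu> < onorm_on (hilb HX) (ind HY B \<circ> (PY2 \<circ> T \<circ> PX2) \<circ> ind HX A) \<and> x \<in> A \<and> y \<in> B)"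
        by (intro arg_cong[of _ _ Ex] ext) (auto simp: eq)
      also have "\<dots> \<longleftrightarrow> (y, x) \<in> f"
        unfolding f_def approx_rel_def by auto
      finally show ?thesis .
    qed
    then have "g = f\<inverse>" by auto
    then have "coarse_inverses X \<E> Y \<F> (coarse_class X \<E> Y \<F> f) (coarse_class Y \<F> X \<E> g)"
      using coarse_inverses_converse[OF X Y f] g by simp
    then show "let f = approx_rel HX HY (PY2 \<circ> T \<circ> PX2) (\<delta> - \<mu>) F E;
           g = approx_rel HY HX (PX2 \<circ> Ts \<circ> PY2) (\<delta> - \<mu>) E F
       in coarse_rel X \<E> Y \<F> f \<and> coarse_rel Y \<F> X \<E> g \<and>
          coarse_equivalence X \<E> Y \<F> (coarse_class X \<E> Y \<F> f) \<and>
          coarse_inverses X \<E> Y \<F> (coarse_class X \<E> Y \<F> f) (coarse_class Y \<F> X \<E> g)"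
      using f g unfolding Let_def coarse_equivalence_def f_def[symmetric] g_def[symmetric] by blast
  qed
qed

end
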